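(* Consider a tenable balanced affine two-colour urn that grows by sampling sets of size $m$ with replacement (model $\mathcal R$) or without replacement (model $\mathcal M$), with index $\Lambda=\frac m\sigma(a_{m-1}-a_m)\le\frac12$, and assume that the urn is nondegenerate: $\sigma\ge1$, $T_0+m(a_{m-1}-a_m)>0$, $\Lambda\ne0$, and the urn is not triangular, i.e. $a_m\ne0$ and $b_0\ne0$. Let $W_n$ be the number of white balls after $n$ draws. Then, with $\xrightarrow{\ D\ }$ denoting convergence in distribution as $n\to\infty$ and $\mathcal N(0,s)$ the centered normal law with variance $s$, $$\frac{W_n-\frac{a_m}{1-\Lambda}\,n}{\sqrt n}\ \xrightarrow{\ D\ }\ \mathcal N\Bigl(0,\frac{a_mb_0\Lambda^2}{m(1-\Lambda)^2(1-2\Lambda)}\Bigr)\quad\text{if }\Lambda<\tfrac12,$$ and $$\frac{W_n-2a_m\,n}{\sqrt{n\log n}}\ \xrightarrow{\ D\ }\ \mathcal N\Bigl(0,\frac{a_mb_0}{m}\Bigr)\quad\text{if }\Lambda=\tfrac12.$$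
   Context: Urn setting. Let $m\ge1$ be an integer (sample size), and let $a_k,b_k$ ($0\le k\le m$) be integers with $a_k+b_k=\sigma$ for all $k$ (the urn is balanced), where $\sigma\ge1$. The urn starts with $W_0,B_0\in\mathbb N_0$ white and black balls, $T_0=W_0+B_0\ge m$. At step $n\ge1$ a sample of $m$ balls is drawn from the urn, which contains $W_{n-1}$ white and $B_{n-1}$ black balls; the sample is returned, and if it contained $k$ white and $m-k$ black balls, then $a_{m-k}$ white and $b_{m-k}$ black balls are added (negative numbers mean removal). Thus $T_n=W_n+B_n=T_0+\sigma n$. $\mathbb F_n$ is the $\sigma$-field generated by the first $n$ draws. Sampling models. Given $\mathbb F_{n-1}$, the probability that the $n$-th sample contains exactly $k$ white balls ($0\le k\le m$) is $\binom{W_{n-1}}{k}\binom{T_{n-1}-W_{n-1}}{m-k}\big/\binom{T_{n-1}}{m}$ in model $\mathcal M$ (without replacement) and $\binom mk W_{n-1}^k(T_{n-1}-W_{n-1})^{m-k}/T_{n-1}^m$ in model $\mathcal R$ (with replacement). Tenability: in model $\mathcal M$, $a_k\ge-(m-k)$ and $b_k\ge -k$ for $0\le k\le m$; in model $\mathcal R$, $a_k\ge-1$ for $0\le k\le m-1$, $a_m\ge0$, $b_k\ge-1$ for $1\le k\le m$, $b_0\ge0$. Affine urn: $a_k=(m-k)a_{m-1}-(m-k-1)a_m$ for $0\le k\le m$. *)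

theory Defs
  imports "HOL-Probability.Probability"
begin

datatype sampling_model =
    Model_M  (* without replacement *)
  | Model_R  (* with replacement *)

text \<open>
  The replacement matrix of the urn is given by the sequences \<open>a\<close> and \<open>b\<close>, of which only the
  entries \<open>0, \<dots>, m\<close> are used: a sample with \<open>k\<close> white and \<open>m - k\<close> black balls leads to
  the addition of \<open>a (m - k)\<close> white and \<open>b (m - k)\<close> black balls.
\<close>

definition balanced_urn :: "nat \<Rightarrow> (nat \<Rightarrow> int) \<Rightarrow> (nat \<Rightarrow> int) \<Rightarrow> int \<Rightarrow> bool" where
  "balanced_urn m a b \<sigma> \<longleftrightarrow> (\<forall>k\<le>m. a k + b k = \<sigma>)"

definition affine_urn :: "nat \<Rightarrow> (nat \<Rightarrow> int) \<Rightarrow> bool" where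
  "affine_urn m a \<longleftrightarrow>
     (\<forall>k\<le>m. a k = (int m - int k) * a (m - 1) - (int m - int k - 1) * a m)"

fun tenable :: "sampling_model \<Rightarrow> nat \<Rightarrow> (nat \<Rightarrow> int) \<Rightarrow> (nat \<Rightarrow> int) \<Rightarrow> bool" where
  "tenable Model_M m a b \<longleftrightarrow>
     (\<forall>k\<le>m. a k \<ge> - (int m - int k) \<and> b k \<ge> - int k)"
| "tenable Model_R m a b \<longleftrightarrow>
     (\<forall>k<m. a k \<ge> -1) \<and> a m \<ge> 0 \<and> (\<forall>k\<in>{1..m}. b k \<ge> -1) \<and> b 0 \<ge> 0"

definition urn_index :: "nat \<Rightarrow> (nat \<Rightarrow> int) \<Rightarrow> int \<Rightarrow> real" where
  "urn_index m a \<sigma> = real m / of_int \<sigma> * of_int (a (m - 1) - a m)"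

text \<open>
  \<open>K n \<omega>\<close> is the number of white balls in the \<open>n\<close>-th sample, for \<open>n \<ge> 1\<close> (\<open>K 0\<close> is not used).
  The contents of the urn are integers, so that they are defined for every sequence of draws; in
  a tenable urn they are almost surely nonnegative.
\<close>

primrec white_balls ::
    "(nat \<Rightarrow> int) \<Rightarrow> nat \<Rightarrow> nat \<Rightarrow> (nat \<Rightarrow> 'w \<Rightarrow> nat) \<Rightarrow> nat \<Rightarrow> 'w \<Rightarrow> int" where
  "white_balls a m W0 K 0 \<omega> = int W0"
| "white_balls a m W0 K (Suc n) \<omega> = white_balls a m W0 K n \<omega> + a (m - K (Suc n) \<omega>)"

primrec black_balls ::
    "(nat \<Rightarrow> int) \<Rightarrow> nat \<Rightarrow> nat \<Rightarrow> (nat \<Rightarrow> 'w \<Rightarrow> nat) \<Rightarrow> nat \<Rightarrow> 'w \<Rightarrow> int" where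
  "black_balls b m B0 K 0 \<omega> = int B0"
| "black_balls b m B0 K (Suc n) \<omega> = black_balls b m B0 K n \<omega> + b (m - K (Suc n) \<omega>)"

text \<open>
  The probability that a sample of size \<open>m\<close> from an urn with \<open>w\<close> white and \<open>v\<close> black balls
  contains exactly \<open>k\<close> white balls.
\<close>

fun sample_prob :: "sampling_model \<Rightarrow> nat \<Rightarrow> int \<Rightarrow> int \<Rightarrow> nat \<Rightarrow> real" where
  "sample_prob Model_M m w v k =
     real (nat w choose k) * real (nat v choose (m - k)) / real (nat (w + v) choose m)"
| "sample_prob Model_R m w v k =
     real (m choose k) * of_int w ^ k * of_int v ^ (m - k) / of_int (w + v) ^ m"

definition draws_algebra :: "'w measure \<Rightarrow> (nat \<Rightarrow> 'w \<Rightarrow> nat) \<Rightarrow> nat \<Rightarrow> 'w measure" where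
  "draws_algebra M K n = sigma (space M) {K i -` A \<inter> space M | i A. 1 \<le> i \<and> i \<le> n}"

definition urn_process ::
    "sampling_model \<Rightarrow> nat \<Rightarrow> (nat \<Rightarrow> int) \<Rightarrow> (nat \<Rightarrow> int) \<Rightarrow> nat \<Rightarrow> nat \<Rightarrow>
     'w measure \<Rightarrow> (nat \<Rightarrow> 'w \<Rightarrow> nat) \<Rightarrow> bool" where
  "urn_process mdl m a b W0 B0 M K \<longleftrightarrow>
     prob_space M \<and>
     (\<forall>n\<ge>1. K n \<in> measurable M (count_space {..m})) \<and>
     (\<forall>n. \<forall>k\<le>m. AE \<omega> in M.
        real_cond_exp M (draws_algebra M K n) (indicator {\<omega> \<in> space M. K (Suc n) \<omega> = k}) \<omega> =
        sample_prob mdl m (white_balls a m W0 K n \<omega>) (black_balls b m B0 K n \<omega>) k)"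

text \<open>
  The normal law with mean \<open>\<mu>\<close> and variance \<open>s > 0\<close>; the second parameter of \<open>normal_density\<close>
  is the standard deviation.
\<close>

definition normal_law :: "real \<Rightarrow> real \<Rightarrow> real measure" where
  "normal_law \<mu> s = density lborel (normal_density \<mu> (sqrt s))"

end

theory Submission
  imports Defs "HOL-Real_Asymp.Real_Asymp"
begin

text \<open>
  Let \<open>p = a\<^sub>m / (\<sigma> (1 - \<Lambda>))\<close> and \<open>X\<^sub>n = W\<^sub>n - p T\<^sub>n\<close>. For an affine urn,
  \<open>X\<^sub>n\<^sub>+\<^sub>1 = G\<^sub>n X\<^sub>n + \<xi>\<^sub>n\<^sub>+\<^sub>1\<close>, where \<open>G\<^sub>n = 1 + \<Lambda> \<sigma> / T\<^sub>n\<close> and the increment \<open>\<xi>\<close> is bounded,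
  conditionally centred, and has a conditional variance that tends to a constant \<open>v\<close> in mean. The
  characteristic function \<open>\<phi>\<^sub>n\<close> of \<open>X\<^sub>n\<close> therefore satisfies
  \<open>\<phi>\<^sub>n\<^sub>+\<^sub>1(t) = \<phi>\<^sub>n(G\<^sub>n t) exp(- v t\<^sup>2 / 2)\<close> up to an error \<open>o(t\<^sup>2) + O(|t|\<^sup>3)\<close>, and the solution of the
  unperturbed recursion is Gaussian. The variance and the coefficients of \<open>|t|\<close>, \<open>t\<^sup>2\<close>, \<open>|t|\<^sup>3\<close> in
  the accumulated error all solve recursions \<open>x\<^sub>n\<^sub>+\<^sub>1 = G\<^sub>n\<^sup>k x\<^sub>n + y\<^sub>n\<close>, whose growth is compared with
  powers of a scale \<open>S\<^sub>n\<close>, namely \<open>n\<close> or \<open>n log n\<close>; Levy's continuity theorem concludes.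
\<close>

section \<open>Linear recursions\<close>

text \<open>Once \<open>q\<close> stays within \<open>\<eta>\<close> of \<open>L\<close>, the part
  of the distance of \<open>u\<close> from \<open>L\<close> in excess of \<open>\<eta>\<close>
  shrinks by the factor \<open>1 - \<rho> n\<close>, which is at most
  \<open>exp (- \<rho> n)\<close>. The product of these factors tends to 0 because the sum of
  \<open>\<rho>\<close> diverges.\<close>

lemma weighted_mean_tendsto:
  fixes u \<rho> q :: "nat \<Rightarrow> real"
  assumes rec: "\<forall>\<^sub>F n in sequentially. u (Suc n) = (1 - \<rho> n) * u n + \<rho> n * q n"
    and \<rho>: "\<forall>\<^sub>F n in sequentially. 0 \<le> \<rho> n \<and> \<rho> n \<le> 1"
    and div: "\<not> summable \<rho>"
    and q: "q \<longlonglongrightarrow> L"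
  shows "u \<longlonglongrightarrow> L"
proof (rule LIMSEQ_I)
  fix r :: real assume "0 < r"
  define \<eta> where "\<eta> = r / 2"
  have "\<eta> > 0" using \<open>0 < r\<close> by (simp add: \<eta>_def)
  have "\<forall>\<^sub>F n in sequentially. \<bar>q n - L\<bar> < \<eta>"
    using tendstoD[OF q \<open>\<eta> > 0\<close>] by (simp add: dist_real_def)
  with rec \<rho> have "\<forall>\<^sub>F n in sequentially. u (Suc n) = (1 - \<rho> n) * u n + \<rho> n * q n \<and>
      0 \<le> \<rho> n \<and> \<rho> n \<le> 1 \<and> \<bar>q n - L\<bar> < \<eta>"
    by eventually_elim auto
  then obtain N where N: "\<And>n. n \<ge> N \<Longrightarrow> u (Suc n) = (1 - \<rho> n) * u n + \<rho> n * q n"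
    "\<And>n. n \<ge> N \<Longrightarrow> 0 \<le> \<rho> n" "\<And>n. n \<ge> N \<Longrightarrow> \<rho> n \<le> 1" "\<And>n. n \<ge> N \<Longrightarrow> \<bar>q n - L\<bar> < \<eta>"
    unfolding eventually_sequentially by blast
  define e where "e n = \<bar>u n - L\<bar>" for n
  define P where "P k = (\<Sum>i<k. \<rho> (i + N))" for k
  have bound: "e (k + N) \<le> \<eta> + exp (- P k) * e N" for k
  proof (induction k)
    case 0 show ?case using \<open>\<eta> > 0\<close> by (simp add: P_def)
  next
    case (Suc k)
    let ?\<rho> = "\<rho> (k + N)"
    have \<rho>': "0 \<le> ?\<rho>" "?\<rho> \<le> 1" using N by auto
    have "u (Suc (k + N)) - L = (1 - ?\<rho>) * (u (k + N) - L) + ?\<rho> * (q (k + N) - L)"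
      by (subst N(1)) (auto simp: algebra_simps)
    hence "e (Suc (k + N)) \<le> \<bar>(1 - ?\<rho>) * (u (k + N) - L)\<bar> + \<bar>?\<rho> * (q (k + N) - L)\<bar>"
      unfolding e_def by linarith
    also have "\<dots> = (1 - ?\<rho>) * e (k + N) + ?\<rho> * \<bar>q (k + N) - L\<bar>"
      using \<rho>' by (simp add: e_def abs_mult)
    also have "\<dots> \<le> (1 - ?\<rho>) * (\<eta> + exp (- P k) * e N) + ?\<rho> * \<eta>"
      using \<rho>' N(4)[of "k + N"] Suc.IH by (intro add_mono mult_left_mono) auto
    also have "\<dots> = \<eta> + (1 - ?\<rho>) * (exp (- P k) * e N)" by (simp add: algebra_simps)
    also have "\<dots> \<le> \<eta> + exp (- ?\<rho>) * (exp (- P k) * e N)"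
      using exp_ge_add_one_self[of "- ?\<rho>"]
      by (intro add_left_mono mult_right_mono) (auto simp: e_def)
    also have "\<dots> = \<eta> + exp (- P (Suc k)) * e N"
      by (simp add: P_def exp_add[symmetric] mult.assoc[symmetric])
    finally show ?case by simp
  qed
  \<comment> \<open>If the remnant of the starting error never fell below \<open>\<eta>\<close>, the
    partial sums \<open>P k\<close> would be bounded by \<open>ln (e N / \<eta>)\<close> and
    \<open>\<rho>\<close> would be summable.\<close>
  have "\<exists>k. exp (- P k) * e N < \<eta>"
  proof (rule ccontr)
    assume "\<nexists>k. exp (- P k) * e N < \<eta>"
    hence *: "\<eta> \<le> exp (- P k) * e N" for k by (meson not_le)
    have "e N > 0" using *[of 0] \<open>\<eta> > 0\<close> by (simp add: P_def)
    have "P k \<le> ln (e N / \<eta>)" for k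
      using *[of k] \<open>e N > 0\<close> \<open>\<eta> > 0\<close>
      by (simp add: ln_ge_iff exp_minus field_simps)
    hence "summable (\<lambda>i. \<rho> (i + N))"
      using N(2) by (intro summableI_nonneg_bounded[where x = "ln (e N / \<eta>)"]) (auto simp: P_def)
    thus False using div by (simp add: summable_iff_shift)
  qed
  then obtain k0 where k0: "exp (- P k0) * e N < \<eta>" by blast
  have "norm (u n - L) < r" if n: "n \<ge> k0 + N" for n
  proof -
    obtain k where k: "n = k + N" "k \<ge> k0"
      using n that[of "n - N"] by auto
    have "P k0 \<le> P k" unfolding P_def using k N(2) by (intro sum_mono2) auto
    hence "exp (- P k) * e N \<le> exp (- P k0) * e N" by (intro mult_right_mono) (auto simp: e_def)
    with bound[of k] k0 show ?thesis by (simp add: k e_def \<eta>_def)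
  qed
  thus "\<exists>no. \<forall>n\<ge>no. norm (u n - L) < r" by blast
qed

text \<open>A form of the Stolz-Cesaro theorem: \<open>x n / z n\<close> follows a weighted mean
  recursion with weight \<open>1 - G n * z n / z (Suc n)\<close>, pulled towards the quotient of the
  two forcing terms \<open>y n\<close> and \<open>z (Suc n) - G n * z n\<close>.\<close>

lemma linear_recursion_ratio:
  fixes x y z G :: "nat \<Rightarrow> real"
  assumes rec: "\<And>n. x (Suc n) = G n * x n + y n"
    and pos: "\<forall>\<^sub>F n in sequentially. 0 < z n" "\<And>n. 0 \<le> G n"
    and less: "\<forall>\<^sub>F n in sequentially. G n * z n < z (Suc n)"
    and div: "\<not> summable (\<lambda>n. 1 - G n * z n / z (Suc n))"
    and lim: "(\<lambda>n. y n / (z (Suc n) - G n * z n)) \<longlonglongrightarrow> L"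
  shows "(\<lambda>n. x n / z n) \<longlonglongrightarrow> L"
proof (rule weighted_mean_tendsto[OF _ _ div lim])
  have pos': "\<forall>\<^sub>F n in sequentially. 0 < z (Suc n)"
    using pos(1) by (subst eventually_sequentially_Suc)
  show "\<forall>\<^sub>F n in sequentially. x (Suc n) / z (Suc n) =
      (1 - (1 - G n * z n / z (Suc n))) * (x n / z n) +
      (1 - G n * z n / z (Suc n)) * (y n / (z (Suc n) - G n * z n))"
    using pos(1) pos' less
  proof eventually_elim
    case (elim n)
    have "1 - G n * z n / z (Suc n) = (z (Suc n) - G n * z n) / z (Suc n)"
      using elim by (simp add: field_simps)
    thus ?case using elim by (simp add: rec) (simp add: field_simps)
  qed
  show "\<forall>\<^sub>F n in sequentially. 0 \<le> 1 - G n * z n / z (Suc n) \<and> 1 - G n * z n / z (Suc n) \<le> 1"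
    using pos(1) pos' less by eventually_elim (use pos(2) in auto)
qed

text \<open>A convergent sum of \<open>f\<close> would make the increments of \<open>F\<close>
  summable and hence \<open>F\<close> bounded. Below, \<open>F\<close> is a multiple of
  \<open>ln (ln n)\<close>.\<close>

lemma not_summable_telescope:
  fixes f F :: "nat \<Rightarrow> real"
  assumes F: "filterlim F at_top sequentially"
    and le: "\<forall>\<^sub>F n in sequentially. \<bar>F (Suc n) - F n\<bar> \<le> f n"
  shows "\<not> summable f"
proof
  assume "summable f"
  with le have "summable (\<lambda>n. F (Suc n) - F n)"
    by (intro summable_comparison_test_ev[where g = f and f = "\<lambda>n. F (Suc n) - F n"]) simp_all
  hence "(\<lambda>n. F n - F 0) \<longlonglongrightarrow> (\<Sum>n. F (Suc n) - F n)"
    using summable_LIMSEQ[of "\<lambda>n. F (Suc n) - F n"] by (simp add: sum_lessThan_telescope)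
  hence "Bseq (\<lambda>n. F n - F 0)" by (intro convergent_imp_Bseq convergentI)
  then obtain C where "\<And>n. \<bar>F n - F 0\<bar> \<le> C" unfolding Bseq_def by auto
  hence "F n \<le> C + F 0" for n by (smt (verit))
  moreover have "\<forall>\<^sub>F n in sequentially. C + F 0 < F n"
    using F by (simp add: filterlim_at_top_dense)
  ultimately show False by (auto simp: eventually_sequentially not_less[symmetric])
qed

text \<open>\<open>S\<close> nearly solves
  \<open>s (Suc n) = (g n)\<^sup>2 * s n + \<kappa>\<close>, so for \<open>k > 0\<close> the
  sequence \<open>sqrt (S n) ^ k\<close> can be compared with solutions of recursions with
  coefficient \<open>g n ^ k\<close>. Divergence of the sum of \<open>1 / S n\<close> ensures that
  initial values are forgotten.\<close>

locale recursion_scale =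
  fixes g S :: "nat \<Rightarrow> real" and \<kappa> :: real
  assumes g_nonneg: "\<And>n. 0 \<le> g n"
    and S_at_top: "filterlim S at_top sequentially"
    and \<kappa>_pos: "0 < \<kappa>"
    and S_diff: "(\<lambda>n. S (Suc n) - (g n)\<^sup>2 * S n) \<longlonglongrightarrow> \<kappa>"
    and inverse_S: "\<not> summable (\<lambda>n. 1 / S n)"
begin

lemma S_pos: "\<forall>\<^sub>F n in sequentially. 0 < S n"
  using S_at_top by (simp add: filterlim_at_top_dense)

lemma S_pos_Suc: "\<forall>\<^sub>F n in sequentially. 0 < S (Suc n)"
  using S_pos by (subst eventually_sequentially_Suc)

lemma S_diff_ge: "\<forall>\<^sub>F n in sequentially. \<kappa> / 2 < S (Suc n) - (g n)\<^sup>2 * S n"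
  using order_tendstoD(1)[OF S_diff, of "\<kappa> / 2"] \<kappa>_pos by simp

lemma power_sqrt_S_diff_pos:
  assumes "0 < k"
  shows "\<forall>\<^sub>F n in sequentially. g n ^ k * sqrt (S n) ^ k < sqrt (S (Suc n)) ^ k"
  using S_pos S_pos_Suc S_diff_ge
proof eventually_elim
  case (elim n)
  have "(g n * sqrt (S n))\<^sup>2 < (sqrt (S (Suc n)))\<^sup>2"
    using elim \<kappa>_pos by (simp add: power_mult_distrib)
  hence "g n * sqrt (S n) < sqrt (S (Suc n))"
    using elim by (elim power_less_imp_less_base) simp
  hence "(g n * sqrt (S n)) ^ k < sqrt (S (Suc n)) ^ k"
    using assms elim g_nonneg[of n] by (intro power_strict_mono) auto
  thus ?case by (simp only: power_mult_distrib)
qed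

text \<open>With \<open>\<theta>\<close> for the ratio at \<open>k = 1\<close>, eventually \<open>1
  - \<theta> ^ k \<ge> 1 - \<theta> \<ge> (1 - \<theta>\<^sup>2) / 2 \<ge> \<kappa> / (4 * S (Suc
  n))\<close>, and the last terms have a divergent sum.\<close>

lemma not_summable_decay:
  assumes "0 < k"
  shows "\<not> summable (\<lambda>n. 1 - g n ^ k * sqrt (S n) ^ k / sqrt (S (Suc n)) ^ k)"
proof
  assume *: "summable (\<lambda>n. 1 - g n ^ k * sqrt (S n) ^ k / sqrt (S (Suc n)) ^ k)"
  have "\<forall>\<^sub>F n in sequentially.
      norm (\<kappa> / 4 * (1 / S (Suc n))) \<le> 1 - g n ^ k * sqrt (S n) ^ k / sqrt (S (Suc n)) ^ k"
    using S_pos S_pos_Suc S_diff_ge power_sqrt_S_diff_pos[OF zero_less_one]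
  proof eventually_elim
    case (elim n)
    define \<theta> where "\<theta> = g n * sqrt (S n) / sqrt (S (Suc n))"
    have \<theta>: "0 \<le> \<theta>" "\<theta> \<le> 1" using elim g_nonneg[of n] by (auto simp: \<theta>_def)
    have "\<theta>\<^sup>2 = (g n)\<^sup>2 * S n / S (Suc n)"
      using elim by (simp add: \<theta>_def power_mult_distrib power_divide)
    hence "1 - \<theta>\<^sup>2 = (S (Suc n) - (g n)\<^sup>2 * S n) / S (Suc n)" using elim by (simp add: field_simps)
    also have "\<dots> \<ge> (\<kappa> / 2) / S (Suc n)" using elim by (intro divide_right_mono) auto
    finally have "(\<kappa> / 2) / S (Suc n) \<le> 1 - \<theta>\<^sup>2" .
    also have "1 - \<theta>\<^sup>2 = (1 - \<theta>) * (1 + \<theta>)" by (simp add: power2_eq_square algebra_simps)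
    also have "\<dots> \<le> (1 - \<theta>) * 2" using \<theta> by (intro mult_left_mono) auto
    finally have "\<kappa> / 4 * (1 / S (Suc n)) \<le> 1 - \<theta>" by simp
    also have "\<theta> ^ k \<le> \<theta> ^ 1" using \<theta> assms by (intro power_decreasing) auto
    hence "1 - \<theta> \<le> 1 - \<theta> ^ k" by simp
    finally show ?case using elim \<kappa>_pos by (simp add: \<theta>_def power_mult_distrib power_divide)
  qed
  from summable_comparison_test_ev[OF this *] have "summable (\<lambda>n. 1 / S (Suc n))"
    using \<kappa>_pos by (subst (asm) summable_cmult_iff) auto
  thus False using inverse_S by (simp add: summable_Suc_iff[of "\<lambda>n. 1 / S n"])
qed

lemma power_recursion_ratio:
  assumes "0 < k" and "\<And>n. x (Suc n) = g n ^ k * x n + y n"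
    and "(\<lambda>n. y n / (sqrt (S (Suc n)) ^ k - g n ^ k * sqrt (S n) ^ k)) \<longlonglongrightarrow> L"
  shows "(\<lambda>n. x n / sqrt (S n) ^ k) \<longlonglongrightarrow> L"
proof (rule linear_recursion_ratio[OF assms(2) _ _ power_sqrt_S_diff_pos not_summable_decay
    assms(3)])
  show "\<forall>\<^sub>F n in sequentially. 0 < sqrt (S n) ^ k"
    using S_pos by eventually_elim simp
qed (use assms(1) g_nonneg in auto)

text \<open>Used to make the initial state of the urn disappear in the limit.\<close>

lemma recursion_ratio_1:
  assumes "\<And>n. x (Suc n) = g n * x n"
  shows "(\<lambda>n. x n / sqrt (S n)) \<longlonglongrightarrow> 0"
  using power_recursion_ratio[of 1 x "\<lambda>_. 0" 0] assms by simp

text \<open>Constant forcing \<open>y = v\<close> yields the limiting variance; forcing that tends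
  to 0 yields a negligible error.\<close>

lemma recursion_ratio_2:
  assumes "\<And>n. x (Suc n) = (g n)\<^sup>2 * x n + y n" and "y \<longlonglongrightarrow> L"
  shows "(\<lambda>n. x n / S n) \<longlonglongrightarrow> L / \<kappa>"
proof -
  have *: "\<forall>\<^sub>F n in sequentially. S n = (sqrt (S n))\<^sup>2 "
    using S_pos by eventually_elim simp
  have "(\<lambda>n. x n / (sqrt (S n))\<^sup>2) \<longlonglongrightarrow> L / \<kappa>"
  proof (rule power_recursion_ratio[OF _ assms(1)])
    have "(\<lambda>n. y n / (S (Suc n) - (g n)\<^sup>2 * S n)) \<longlonglongrightarrow> L / \<kappa>"
      using \<kappa>_pos by (intro tendsto_divide assms S_diff) auto
    moreover have "\<forall>\<^sub>F n in sequentially. y n / (S (Suc n) - (g n)\<^sup>2 * S n) =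
        y n / ((sqrt (S (Suc n)))\<^sup>2 - (g n)\<^sup>2 * (sqrt (S n))\<^sup>2)"
      using S_pos S_pos_Suc by eventually_elim simp
    ultimately show "(\<lambda>n. y n / ((sqrt (S (Suc n)))\<^sup>2 - (g n)\<^sup>2 * (sqrt (S n))\<^sup>2)) \<longlonglongrightarrow> L / \<kappa>"
      by (rule Lim_transform_eventually)
  qed simp
  moreover have "\<forall>\<^sub>F n in sequentially. x n / (sqrt (S n))\<^sup>2 = x n / S n"
    using S_pos by eventually_elim simp
  ultimately show ?thesis by (rule Lim_transform_eventually)
qed

text \<open>Bounding one factor \<open>g n * sqrt (S n)\<close> by \<open>sqrt (S (Suc n))\<close>
  shows that the difference of cubes is at least \<open>\<kappa> / 2 * sqrt (S (Suc n))\<close>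
  eventually. It tends to infinity, so constant forcing is negligible.\<close>

lemma recursion_ratio_3:
  assumes "\<And>n. x (Suc n) = g n ^ 3 * x n + c"
  shows "(\<lambda>n. x n / sqrt (S n) ^ 3) \<longlonglongrightarrow> 0"
proof (rule power_recursion_ratio[OF _ assms])
  have "filterlim (\<lambda>n. \<kappa> / 2 * sqrt (S (Suc n))) at_top sequentially"
    using \<kappa>_pos S_at_top
    by (intro filterlim_tendsto_pos_mult_at_top[OF tendsto_const]
          filterlim_compose[OF sqrt_at_top] filterlim_compose[OF S_at_top filterlim_Suc]) auto
  moreover have "\<forall>\<^sub>F n in sequentially.
      \<kappa> / 2 * sqrt (S (Suc n)) \<le> sqrt (S (Suc n)) ^ 3 - g n ^ 3 * sqrt (S n) ^ 3"
    using S_pos S_pos_Suc S_diff_ge power_sqrt_S_diff_pos[OF zero_less_one]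
  proof eventually_elim
    case (elim n)
    let ?s = "sqrt (S n)" and ?s' = "sqrt (S (Suc n))"
    have "g n ^ 3 * ?s ^ 3 = (g n * ?s) * ((g n)\<^sup>2 * S n)"
      using elim by (simp add: power3_eq_cube power2_eq_square)
    also have "\<dots> \<le> ?s' * ((g n)\<^sup>2 * S n)"
      using elim by (intro mult_right_mono) auto
    finally have 1: "g n ^ 3 * ?s ^ 3 \<le> ?s' * ((g n)\<^sup>2 * S n)" .
    have "\<kappa> / 2 * ?s' \<le> (S (Suc n) - (g n)\<^sup>2 * S n) * ?s'"
      using elim by (intro mult_right_mono) auto
    also have "\<dots> = ?s' ^ 3 - ?s' * ((g n)\<^sup>2 * S n)"
      using elim by (simp add: power3_eq_cube algebra_simps)
    finally show ?case using 1 by linarith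
  qed
  ultimately have "filterlim (\<lambda>n. sqrt (S (Suc n)) ^ 3 -
      g n ^ 3 * sqrt (S n) ^ 3) at_top sequentially"
    by (rule filterlim_at_top_mono)
  thus "(\<lambda>n. c / (sqrt (S (Suc n)) ^ 3 - g n ^ 3 * sqrt (S n) ^ 3)) \<longlonglongrightarrow> 0"
    by (intro tendsto_divide_0[OF tendsto_const] filterlim_at_top_imp_at_infinity)
qed simp

end

section \<open>The scales n and n log n\<close>

lemma recursion_scale_linear:
  fixes \<Lambda> \<tau> :: real
  assumes "\<Lambda> < 1/2" "\<And>n. 0 \<le> 1 + \<Lambda> / (real n + \<tau>)"
  shows "recursion_scale (\<lambda>n. 1 + \<Lambda> / (real n + \<tau>)) real (1 - 2 * \<Lambda>)"
proof
  \<comment> \<open>Since \<open>(1 + \<Lambda> / (n + \<tau>))\<^sup>2 * n = n + 2 * \<Lambda> +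
    o(1)\<close>, the limit is \<open>1 - 2 * \<Lambda>\<close>, which is positive exactly for
    \<open>\<Lambda> < 1/2\<close>.\<close>
  show "(\<lambda>n. real (Suc n) - (1 + \<Lambda> / (real n + \<tau>))\<^sup>2 * real n) \<longlonglongrightarrow> 1 - 2 * \<Lambda>"
    by real_asymp
  show "\<not> summable (\<lambda>n. 1 / real n)"
    using not_summable_harmonic[where 'a=real] by (simp add: inverse_eq_divide)
qed (use assms in \<open>auto simp: filterlim_real_sequentially\<close>)

lemma recursion_scale_log:
  fixes \<tau> :: real
  assumes "\<And>n. 0 \<le> 1 + 1 / 2 / (real n + \<tau>)"
  shows "recursion_scale (\<lambda>n. 1 + 1 / 2 / (real n + \<tau>)) (\<lambda>n. real n * ln (real n)) 1"
proof
  show "filterlim (\<lambda>n. real n * ln (real n)) at_top sequentially" by real_asymp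
  \<comment> \<open>At index 1/2 the scale \<open>n\<close> would give the limit 0. With the
    logarithm both terms equal \<open>n ln n + ln n\<close> up to bounded terms; the remaining 1 is
    the limit of \<open>n (ln (n + 1) - ln n)\<close>.\<close>
  show "(\<lambda>n. real (Suc n) * ln (real (Suc n)) -
      (1 + 1 / 2 / (real n + \<tau>))\<^sup>2 * (real n * ln (real n))) \<longlonglongrightarrow> 1"
    by real_asymp
  \<comment> \<open>The increments of \<open>ln (ln n)\<close> are asymptotic to
    \<open>1 / (n * ln n)\<close>; the factor 1/2 leaves room for the comparison.\<close>
  have "filterlim (\<lambda>n. 1/2 * ln (ln (real n))) at_top sequentially" by real_asymp
  moreover have "\<forall>\<^sub>F n in sequentially. \<bar>1/2 * ln (ln (real (Suc n))) - 1/2 * ln (ln (real n))\<bar>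
      \<le> 1 / (real n * ln (real n))"
    by real_asymp
  ultimately show "\<not> summable (\<lambda>n. 1 / (real n * ln (real n)))"
    by (rule not_summable_telescope)
qed (use assms in auto)

section \<open>Moments of a sample\<close>

lemma sum_of_nat_mult_Suc_atMost:
  fixes f :: "nat \<Rightarrow> real"
  shows "(\<Sum>k\<le>Suc m. real k * f k) = (\<Sum>k\<le>m. real (Suc k) * f (Suc k))"
  by (subst sum.atMost_Suc_shift) simp

text \<open>The absorption identity
  \<open>Suc k * (Suc w choose Suc k) = Suc w * (w choose k)\<close> leaves the Vandermonde
  convolution for one white ball fewer.\<close>

lemma vandermonde_first_moment:
  "(\<Sum>k\<le>Suc m. real k * (real (Suc w choose k) * real (v choose (Suc m - k)))) =
     real (Suc w) * real ((w + v) choose m)"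
proof -
  have "(\<Sum>k\<le>Suc m. real k * (real (Suc w choose k) * real (v choose (Suc m - k)))) =
      (\<Sum>k\<le>m. real (Suc w) * real ((w choose k) * (v choose (m - k))))"
    unfolding sum_of_nat_mult_Suc_atMost
  proof (intro sum.cong refl)
    fix k
    have "real (Suc k) * real (Suc w choose Suc k) = real (Suc w) * real (w choose k)"
      using Suc_times_binomial[of k w] by (metis of_nat_mult)
    thus "real (Suc k) * (real (Suc w choose Suc k) * real (v choose (Suc m - Suc k))) =
        real (Suc w) * real ((w choose k) * (v choose (m - k)))"
      by simp
  qed
  also have "\<dots> = real (Suc w) * real (\<Sum>k\<le>m. (w choose k) * (v choose (m - k)))"
    by (simp only: of_nat_sum sum_distrib_left)
  finally show ?thesis by (simp only: vandermonde)
qed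

text \<open>One absorption uses up one of the two factors and leaves the first moment for one white
  ball fewer.\<close>

lemma vandermonde_second_moment:
  "(\<Sum>k\<le>Suc (Suc m). real k * (real k - 1) *
      (real (Suc (Suc w) choose k) * real (v choose (Suc (Suc m) - k)))) =
     real (Suc (Suc w)) * real (Suc w) * real ((w + v) choose m)"
proof -
  have "(\<Sum>k\<le>Suc (Suc m). real k * (real k - 1) *
      (real (Suc (Suc w) choose k) * real (v choose (Suc (Suc m) - k)))) =
      (\<Sum>k\<le>Suc m. real (Suc k) * (real k *
        (real (Suc (Suc w) choose Suc k) * real (v choose (Suc m - k)))))"
    by (subst sum.atMost_Suc_shift) (simp add: mult.assoc)
  also have "\<dots> = (\<Sum>k\<le>Suc m. real (Suc (Suc w)) *
       (real k * (real (Suc w choose k) * real (v choose (Suc m - k)))))"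
  proof (intro sum.cong refl)
    fix k
    have "real (Suc k) * real (Suc (Suc w) choose Suc k) =
        real (Suc (Suc w)) * real (Suc w choose k)"
      using Suc_times_binomial[of k "Suc w"] by (metis of_nat_mult)
    thus "real (Suc k) * (real k *
        (real (Suc (Suc w) choose Suc k) * real (v choose (Suc m - k)))) =
      real (Suc (Suc w)) *
       (real k * (real (Suc w choose k) * real (v choose (Suc m - k))))"
      by (metis (no_types, opaque_lifting) mult.left_commute mult.assoc)
  qed
  also have "\<dots> = real (Suc (Suc w)) * (real (Suc w) * real ((w + v) choose m))"
    by (simp only: sum_distrib_left[symmetric] vandermonde_first_moment)
  finally show ?thesis by simp
qed

lemma mult_cross_left:
  fixes a b c d :: real
  assumes "a * b = c * d"
  shows "a * (b * x) = c * (d * x)"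
  using assms by (simp add: mult.assoc[symmetric])

lemma binomial_first_moment:
  fixes x y :: real
  shows "(\<Sum>k\<le>Suc m. real k * (real (Suc m choose k) * x ^ k * y ^ (Suc m - k))) =
    real (Suc m) * x * (x + y) ^ m"
proof -
  have "(\<Sum>k\<le>Suc m. real k * (real (Suc m choose k) * x ^ k * y ^ (Suc m - k))) =
      (\<Sum>k\<le>m. real (Suc m) * x * (real (m choose k) * x ^ k * y ^ (m - k)))"
    unfolding sum_of_nat_mult_Suc_atMost
  proof (intro sum.cong refl)
    fix k
    have "real (Suc k) * real (Suc m choose Suc k) = real (Suc m) * real (m choose k)"
      using Suc_times_binomial[of k m] by (metis of_nat_mult)
    thus "real (Suc k) * (real (Suc m choose Suc k) * x ^ Suc k * y ^ (Suc m - Suc k)) =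
        real (Suc m) * x * (real (m choose k) * x ^ k * y ^ (m - k))"
      using mult_cross_left[where x = "x * x ^ k * y ^ (m - k)"]
      by (simp only: diff_Suc_Suc power_Suc) (simp add: mult_ac del: of_nat_Suc binomial_Suc_Suc)
  qed
  thus ?thesis by (simp only: sum_distrib_left[symmetric] binomial_ring[of x y m] of_nat_id)
qed

lemma binomial_second_moment:
  fixes x y :: real
  shows "(\<Sum>k\<le>Suc (Suc m). real k * (real k - 1) *
      (real (Suc (Suc m) choose k) * x ^ k * y ^ (Suc (Suc m) - k))) =
    real (Suc (Suc m)) * real (Suc m) * x\<^sup>2 * (x + y) ^ m"
proof -
  have "(\<Sum>k\<le>Suc (Suc m). real k * (real k - 1) *
      (real (Suc (Suc m) choose k) * x ^ k * y ^ (Suc (Suc m) - k))) =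
      (\<Sum>k\<le>Suc m. real (Suc k) * (real k *
        (real (Suc (Suc m) choose Suc k) * x ^ Suc k * y ^ (Suc m - k))))"
    by (subst sum.atMost_Suc_shift) (simp add: mult.assoc)
  also have "\<dots> = (\<Sum>k\<le>Suc m. real (Suc (Suc m)) * x *
       (real k * (real (Suc m choose k) * x ^ k * y ^ (Suc m - k))))"
  proof (intro sum.cong refl)
    fix k
    have "real (Suc k) * real (Suc (Suc m) choose Suc k) =
        real (Suc (Suc m)) * real (Suc m choose k)"
      using Suc_times_binomial[of k "Suc m"] by (metis of_nat_mult)
    thus "real (Suc k) * (real k *
        (real (Suc (Suc m) choose Suc k) * x ^ Suc k * y ^ (Suc m - k))) =
      real (Suc (Suc m)) * x *
       (real k * (real (Suc m choose k) * x ^ k * y ^ (Suc m - k)))"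
      using mult_cross_left[where x = "real k * x * x ^ k * y ^ (Suc m - k)"]
      by (simp only: power_Suc) (simp add: mult_ac del: of_nat_Suc binomial_Suc_Suc)
  qed
  also have "\<dots> = real (Suc (Suc m)) * x * (real (Suc m) * x * (x + y) ^ m)"
    by (simp only: sum_distrib_left[symmetric] binomial_first_moment)
  finally show ?thesis by (simp add: power2_eq_square)
qed

section \<open>Mean and variance of a sample in both models\<close>

context
  fixes mdl :: sampling_model and m :: nat and w v :: int and T :: real
  assumes w: "0 \<le> w" and v: "0 \<le> v" and m: "1 \<le> m" "int m \<le> w + v"
    and T_def: "T = of_int (w + v)"
begin

lemma sample_prob_nonneg: "0 \<le> sample_prob mdl m w v k"
  using w v by (cases mdl) auto

lemma sum_sample_prob: "(\<Sum>k\<le>m. sample_prob mdl m w v k) = 1"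
proof (cases mdl)
  case Model_M
  have "(\<Sum>k\<le>m. sample_prob mdl m w v k) =
      real (\<Sum>k\<le>m. (nat w choose k) * (nat v choose (m - k))) / real (nat (w + v) choose m)"
    by (simp add: Model_M sum_divide_distrib)
  also have "\<dots> = 1" using w v m by (simp add: vandermonde nat_add_distrib binomial_eq_0_iff)
  finally show ?thesis .
next
  case Model_R
  have "(\<Sum>k\<le>m. sample_prob mdl m w v k) =
      (\<Sum>k\<le>m. real (m choose k) * of_int w ^ k * of_int v ^ (m - k)) / of_int (w + v) ^ m"
    by (simp add: Model_R sum_divide_distrib)
  also have "\<dots> = 1" using m w v by (simp add: binomial_ring[symmetric])
  finally show ?thesis .
qed

lemma sample_prob_mean: "(\<Sum>k\<le>m. real k * sample_prob mdl m w v k) = real m * of_int w / T"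
proof -
  obtain m' where m': "m = Suc m'" using m by (cases m) auto
  have T: "T > 0" using m by (simp add: T_def)
  show ?thesis
  proof (cases mdl)
    case Model_M
    have sum: "(\<Sum>k\<le>m. real k * sample_prob mdl m w v k) =
        (\<Sum>k\<le>m. real k * (real (nat w choose k) * real (nat v choose (m - k)))) / real (nat (w +
            v) choose m)"
      by (simp add: Model_M sum_divide_distrib)
    show ?thesis
    proof (cases "nat w")
      case 0
      have "(\<Sum>k\<le>m. real k * (real (nat w choose k) * real (nat v choose (m - k)))) = 0"
        by (intro sum.neutral) (auto simp: 0 binomial_eq_0_iff)
      thus ?thesis unfolding sum using 0 w by simp
    next
      case (Suc w')
      define N where "N = w' + nat v"
      have N: "nat (w + v) = Suc N" "T = real (Suc N)" "of_int w = real (Suc w')" "m' \<le> N"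
        using Suc w v m by (auto simp: N_def T_def m')
      have *: "real (Suc m') * real (Suc N choose Suc m') = real (Suc N) * real (N choose m')"
        using Suc_times_binomial[of m' N] by (metis of_nat_mult)
      have "(\<Sum>k\<le>m. real k * sample_prob mdl m w v k) =
          real (Suc w') * real (N choose m') / real (Suc N choose Suc m')"
        unfolding sum unfolding m' Suc vandermonde_first_moment N N_def ..
      also have "\<dots> = real (Suc m') * real (Suc w') / real (Suc N)"
        using * N(4) by (simp add: field_simps del: of_nat_Suc binomial_Suc_Suc)
      finally show ?thesis by (simp only: N m')
    qed
  next
    case Model_R
    have "(\<Sum>k\<le>m. real k * sample_prob mdl m w v k) =
        (\<Sum>k\<le>m. real k * (real (m choose k) * of_int w ^ k * of_int v ^ (m - k))) / T ^ m"
      by (simp add: Model_R sum_divide_distrib T_def)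
    also have "\<dots> = real m * of_int w * T ^ m' / T ^ Suc m'"
      unfolding m' binomial_first_moment by (simp add: T_def)
    finally show ?thesis using T by simp
  qed
qed

text \<open>With replacement this moment is exactly \<open>m (m - 1) (w / T)\<^sup>2\<close>;
  without replacement it is \<open>m (m - 1) w (w - 1) / (T (T - 1))\<close>. They differ by O(1/T),
  so a single estimate serves both models.\<close>

lemma sample_prob_factorial_moment:
  "\<bar>(\<Sum>k\<le>m. real k * (real k - 1) * sample_prob mdl m w v k)
      - real m * (real m - 1) * (of_int w / T)\<^sup>2\<bar> \<le> 2 * (real m)\<^sup>2 / T"
proof (cases "m = 1")
  \<comment> \<open>For a single draw \<open>k (k - 1)\<close> is always 0. This case is separate
    because \<open>T - 1\<close> may vanish.\<close>
  case True
  have "T > 0" using m by (simp add: T_def)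
  moreover have "{..1::nat} = {0,1}" by auto
  ultimately show ?thesis by (simp add: True)
next
  case False
  then obtain m' where m': "m = Suc (Suc m')" using m by (cases m; cases "m - 1") auto
  have T: "T \<ge> 2" using m by (simp add: T_def m')
  have x: "0 \<le> real_of_int w" "of_int w \<le> T" using w v by (auto simp: T_def)
  show ?thesis
  proof (cases mdl)
    case Model_M
    have sum: "(\<Sum>k\<le>m. real k * (real k - 1) * sample_prob mdl m w v k) =
        (\<Sum>k\<le>m. real k * (real k - 1) * (real (nat w choose k) * real (nat v choose (m -
            k)))) / real (nat (w + v) choose m)"
      by (simp add: Model_M sum_divide_distrib)
    have "(\<Sum>k\<le>m. real k * (real k - 1) * sample_prob mdl m w v k) =
      real m * (real m - 1) * (of_int w * (of_int w - 1)) / (T * (T - 1))"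
    proof (cases "nat w \<le> 1")
      \<comment> \<open>Two absorptions need two white balls; with fewer both sides are 0.\<close>
      case True
      hence w01: "w = 0 \<or> w = 1" using w by auto
      have "real k * (real k - 1) * (real (nat w choose k) * c) = 0" for k and c :: real
        using w01 by (cases "k = 0 \<or> k = 1") (auto simp: binomial_eq_0_iff)
      hence "(\<Sum>k\<le>m. real k * (real k - 1) * (real (nat w choose k) * real (nat v choose (m -
          k)))) = 0"
        by (intro sum.neutral) blast
      thus ?thesis unfolding sum using w01 by auto
    next
      case False
      define w' where "w' = nat w - 2"
      have Suc: "nat w = Suc (Suc w')" using False by (simp add: w'_def)
      define N where "N = w' + nat v"
      have N: "nat (w + v) = Suc (Suc N)" "T = real (Suc (Suc N))" "of_int w =
          real (Suc (Suc w'))" "m' \<le> N"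
        using Suc w v m by (auto simp: N_def T_def m')
      have "real (Suc (Suc m')) * real (Suc (Suc N) choose Suc (Suc m')) =
          real (Suc (Suc N)) * real (Suc N choose Suc m')"
        using Suc_times_binomial[of "Suc m'" "Suc N"] by (metis of_nat_mult)
      moreover have "real (Suc m') * real (Suc N choose Suc m') = real (Suc N) * real (N choose m')"
        using Suc_times_binomial[of m' N] by (metis of_nat_mult)
      ultimately have *: "real (Suc m') * (real (Suc (Suc m')) * real (Suc (Suc N) choose Suc (Suc
          m'))) =
          real (Suc (Suc N)) * (real (Suc N) * real (N choose m'))"
        by (metis mult.left_commute)
      have "(\<Sum>k\<le>m. real k * (real k - 1) * sample_prob mdl m w v k) =
         real (Suc (Suc w')) * real (Suc w') * real (N choose m') / real (Suc (Suc N) choose Suc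
             (Suc m'))"
        unfolding sum unfolding m' Suc vandermonde_second_moment N N_def ..
      also have "\<dots> = real (Suc (Suc m')) * real (Suc m') * (real (Suc (Suc w')) * real (Suc w')) /
          (real (Suc (Suc N)) * real (Suc N))"
      proof -
        have nz: "real (Suc (Suc N) choose Suc (Suc m')) > 0" "real (Suc (Suc N)) * real (Suc N) >
            0"
          using N(4) by (auto simp del: binomial_Suc_Suc of_nat_Suc simp: zero_less_binomial)
        have "a * b * c / d = e * f * (a * b) / (g * h)"
          if "f * (e * d) = g * (h * c)" "d > 0" "g * h > 0" for a b c d e f g h :: real
        proof -
          have "a * b * c * (g * h) = e * f * (a * b) * d" using that(1) by algebra
          thus ?thesis using that by (subst frac_eq_eq) auto
        qed
        from this[OF * nz] show ?thesis .
      qed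
      finally show ?thesis by (simp only: N m') simp
    qed
    also have "\<dots> - real m * (real m - 1) * (of_int w / T)\<^sup>2 =
        real m * (real m - 1) * (of_int w / T) * - ((T - of_int w) / T / (T - 1))"
      using T by (simp add: power2_eq_square divide_simps) algebra
    also have "\<bar>\<dots>\<bar> = real m * (real m - 1) * (of_int w / T) * ((T - of_int w) / T / (T - 1))"
      using x T by (simp add: abs_mult m')
    \<comment> \<open>From \<open>T \<ge> 2\<close> follows \<open>T - 1 \<ge> T / 2\<close>, the
      source of the constant 2.\<close>
    also have "\<dots> \<le> real m * real m * 1 * (1 / (T / 2))"
      using x T by (intro mult_mono frac_le) (auto simp: m')
    also have "\<dots> = 2 * (real m)\<^sup>2 / T" by (simp add: power2_eq_square)
    finally show ?thesis .
  next
    case Model_R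
    have "(\<Sum>k\<le>m. real k * (real k - 1) * sample_prob mdl m w v k) =
        (\<Sum>k\<le>m. real k * (real k - 1) * (real (m choose k) * of_int w ^ k * of_int v ^ (m -
            k))) / T ^ m"
      by (simp add: Model_R sum_divide_distrib T_def)
    also have "\<dots> = real m * (real m - 1) * (of_int w)\<^sup>2 * T ^ m' / T ^ Suc (Suc m')"
      unfolding m' binomial_second_moment by (simp add: T_def)
    also have "\<dots> = real m * (real m - 1) * (of_int w / T)\<^sup>2"
      using T by (simp add: power_divide power2_eq_square)
    finally show ?thesis using T by simp
  qed
qed

text \<open>With \<open>x = w / T\<close>, expand \<open>(k - m x)\<^sup>2 = k (k - 1) + (1 - 2 m x)
  k + (m x)\<^sup>2\<close>. Total mass and mean are exact, so the only error is that of the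
  factorial moment.\<close>

lemma sample_prob_variance:
  "\<bar>(\<Sum>k\<le>m. (real k - real m * of_int w / T)\<^sup>2 * sample_prob mdl m w v k)
      - real m * (of_int w / T) * (1 - of_int w / T)\<bar> \<le> 2 * (real m)\<^sup>2 / T"
proof -
  define x where "x = of_int w / T"
  have "(\<Sum>k\<le>m. (real k - real m * of_int w / T)\<^sup>2 * sample_prob mdl m w v k) =
     (\<Sum>k\<le>m. real k * (real k - 1) * sample_prob mdl m w v k
       + (1 - 2 * real m * x) * (real k * sample_prob mdl m w v k)
       + (real m * x)\<^sup>2 * sample_prob mdl m w v k)"
    by (intro sum.cong refl) (simp add: x_def power2_eq_square algebra_simps)
  also have "\<dots> = (\<Sum>k\<le>m. real k * (real k - 1) * sample_prob mdl m w v k)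
       + (1 - 2 * real m * x) * (real m * x) + (real m * x)\<^sup>2"
    by (simp add: sum.distrib sum_distrib_left[symmetric] sample_prob_mean sum_sample_prob x_def)
  finally show ?thesis
    using sample_prob_factorial_moment
    by (simp add: x_def[symmetric] power2_eq_square algebra_simps)
qed

end

section \<open>The urn process\<close>

locale affine_urn_process =
  fixes mdl :: sampling_model and m W0 B0 :: nat and a b :: "nat \<Rightarrow> int" and \<sigma> :: int
    and M :: "'w measure" and K :: "nat \<Rightarrow> 'w \<Rightarrow> nat"
  assumes m_pos: "m \<ge> 1" and \<sigma>_pos: "\<sigma> \<ge> 1" and m_le: "W0 + B0 \<ge> m"
    and balanced: "balanced_urn m a b \<sigma>"
    and affine: "affine_urn m a"
    and tenable: "tenable mdl m a b"
    and process: "urn_process mdl m a b W0 B0 M K"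
begin

sublocale prob_space M
  using process by (simp add: urn_process_def)

definition T :: "nat \<Rightarrow> int" where "T n = int (W0 + B0) + \<sigma> * int n"

definition d :: int where "d = a (m - 1) - a m"

abbreviation W :: "nat \<Rightarrow> 'w \<Rightarrow> int" where "W \<equiv> white_balls a m W0 K"

text \<open>The total is deterministic, so the black count is eliminated and the white count alone
  drives the dynamics.\<close>

definition draw_prob :: "nat \<Rightarrow> int \<Rightarrow> nat \<Rightarrow> real" where
  "draw_prob n w k = sample_prob mdl m w (T n - w) k"

lemma T_ge: "int m \<le> T n" "1 \<le> T n"
proof -
  have "0 \<le> \<sigma> * int n" using \<sigma>_pos by simp
  thus "int m \<le> T n" using m_le by (simp add: T_def)
  thus "1 \<le> T n" using m_pos by linarith
qed

lemma T_Suc: "T (Suc n) = T n + \<sigma>"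
  by (simp add: T_def algebra_simps)

lemma K_le: "\<omega> \<in> space M \<Longrightarrow> K (Suc n) \<omega> \<le> m"
  using process measurable_space[of "K (Suc n)" M "count_space {..m}" \<omega>]
  by (auto simp: urn_process_def)

lemma a_eq: "k \<le> m \<Longrightarrow> a (m - k) = a m + d * int k"
  using affine[unfolded affine_urn_def, rule_format, of "m - k"]
  by (simp add: d_def of_nat_diff algebra_simps)

lemma a_plus_b: "k \<le> m \<Longrightarrow> a (m - k) + b (m - k) = \<sigma>"
  using balanced by (simp add: balanced_urn_def)

lemma W_Suc: "\<omega> \<in> space M \<Longrightarrow> W (Suc n) \<omega> = W n \<omega> + a m + d * int (K (Suc n) \<omega>)"
  using a_eq[OF K_le] by simp

lemma black_balls_eq: "\<omega> \<in> space M \<Longrightarrow> black_balls b m B0 K n \<omega> = T n - W n \<omega>"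
proof (induction n)
  case (Suc n)
  thus ?case using a_plus_b[OF K_le[OF Suc.prems]] by (simp add: T_Suc algebra_simps)
qed (simp add: T_def)

text \<open>A finite range makes every function of \<open>W n\<close> integrable and turns
  expectations into finite sums.\<close>

lemma finite_W: "finite (W n ` space M)"
proof (induction n)
  case (Suc n)
  have "W (Suc n) ` space M \<subseteq> (\<lambda>(w, k). w + a m + d * int k) ` (W n ` space M \<times> {..m})"
  proof
    fix w assume "w \<in> W (Suc n) ` space M"
    then obtain \<omega> where "\<omega> \<in> space M" "w = W (Suc n) \<omega>" by blast
    thus "w \<in> (\<lambda>(w, k). w + a m + d * int k) ` (W n ` space M \<times> {..m})"
      using W_Suc K_le by (intro image_eqI[where x = "(W n \<omega>, K (Suc n) \<omega>)"]) auto
  qed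
  thus ?case by (rule finite_subset) (use Suc.IH in auto)
qed (simp add: finite_subset[of _ "{int W0}"] image_subset_iff)

section \<open>Measurability and conditioning on the past draws\<close>

lemma K_measurable [measurable]: "K (Suc n) \<in> measurable M (count_space UNIV)"
proof -
  have "K (Suc n) \<in> measurable M (count_space {..m})"
    using process by (auto simp: urn_process_def)
  from measurable_compose[OF this, of "\<lambda>x. x" "count_space UNIV"] show ?thesis by simp
qed

lemma draws_generators: "{K i -` A \<inter> space M | i A. 1 \<le> i \<and> i \<le> n} \<subseteq> Pow (space M)"
  by auto

lemma space_draws_algebra [simp]: "space (draws_algebra M K n) = space M"
  unfolding draws_algebra_def by (rule space_measure_of[OF draws_generators])

lemma subalgebra_draws: "subalgebra M (draws_algebra M K n)"
proof -
  have "K i -` A \<inter> space M \<in> sets M" if "1 \<le> i" for i A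
    using K_measurable[of "i - 1"] that by (auto dest: measurable_sets[of _ _ _ A])
  thus ?thesis
    unfolding subalgebra_def draws_algebra_def sets_measure_of[OF draws_generators]
      space_measure_of[OF draws_generators]
    by (auto intro!: sets.sigma_sets_subset)
qed

lemma K_measurable_draws: "Suc i \<le>
    n \<Longrightarrow> K (Suc i) \<in> measurable (draws_algebra M K n) (count_space UNIV)"
  unfolding measurable_def draws_algebra_def sets_measure_of[OF draws_generators]
    space_measure_of[OF draws_generators]
  by (auto intro!: sigma_sets.Basic)

lemma W_measurable_draws: "i \<le> n \<Longrightarrow> W i \<in> measurable (draws_algebra M K n) (count_space UNIV)"
proof (induction i)
  case (Suc i)
  note [measurable] = K_measurable_draws[OF Suc.prems]
  have [measurable]: "W i \<in> measurable (draws_algebra M K n) (count_space UNIV)" using Suc by simp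
  show ?case by simp
next
  case 0
  have "W 0 = (\<lambda>_. int W0)" by (rule ext) simp
  thus ?case by simp
qed

lemma W_measurable [measurable]: "W n \<in> measurable M (count_space UNIV)"
  using measurable_from_subalg[OF subalgebra_draws W_measurable_draws[OF order_refl]] .

lemma integrable_W [simp]:
  fixes h :: "int \<Rightarrow> 'b :: {banach, second_countable_topology}"
  shows "integrable M (\<lambda>\<omega>. h (W n \<omega>))"
proof (rule integrable_const_bound[where B = "Max ((\<lambda>w. norm (h w)) ` (W n ` space M))"])
  show "AE \<omega> in M. norm (h (W n \<omega>)) \<le> Max ((\<lambda>w. norm (h w)) ` (W n ` space M))"
    using finite_W by (intro AE_I2 Max_ge) auto
qed simp

text \<open>The prescribed conditional law is tested here against the event \<open>W n = w\<close>,
  which the first \<open>n\<close> draws determine.\<close>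

lemma expectation_indicators:
  assumes "k \<le> m"
  shows "(\<integral>\<omega>. indicator {w} (W n \<omega>) * indicator {k} (K (Suc n) \<omega>) \<partial>M) =
    (\<integral>\<omega>. indicator {w} (W n \<omega>) * draw_prob n (W n \<omega>) k \<partial>M)"
proof -
  let ?F = "draws_algebra M K n"
  interpret F: finite_measure_subalgebra M ?F
    using subalgebra_draws by unfold_locales
  let ?g = "indicator {\<omega> \<in> space M. K (Suc n) \<omega> = k} :: 'w \<Rightarrow> real"
  have [measurable]: "(\<lambda>\<omega>. indicator {w} (W n \<omega>) :: real) \<in> borel_measurable ?F"
    by (intro measurable_compose[OF W_measurable_draws[OF order_refl]]) simp
  have [measurable]: "(\<lambda>\<omega>. indicator {w} (W n \<omega>) :: real) \<in> borel_measurable M"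
    by (rule measurable_compose[OF W_measurable]) simp
  have "integrable M (\<lambda>\<omega>. indicator {w} (W n \<omega>) * ?g \<omega>)"
    by (rule integrable_const_bound[where B = 1]) (auto simp: indicator_def)
  from F.real_cond_exp_intg(2)[OF this]
  have "(\<integral>\<omega>. indicator {w} (W n \<omega>) * real_cond_exp M ?F ?g \<omega> \<partial>M) =
      (\<integral>\<omega>. indicator {w} (W n \<omega>) * ?g \<omega> \<partial>M)" by simp
  moreover have "(\<integral>\<omega>. indicator {w} (W n \<omega>) * ?g \<omega> \<partial>M) =
      (\<integral>\<omega>. indicator {w} (W n \<omega>) * indicator {k} (K (Suc n) \<omega>) \<partial>M)"
    by (intro Bochner_Integration.integral_cong) (auto simp: indicator_def)
  moreover have "(\<integral>\<omega>. indicator {w} (W n \<omega>) * real_cond_exp M ?F ?g \<omega> \<partial>M) =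
      (\<integral>\<omega>. indicator {w} (W n \<omega>) * draw_prob n (W n \<omega>) k \<partial>M)"
  proof (rule integral_cong_AE)
    have "AE \<omega> in M. real_cond_exp M ?F ?g \<omega> =
        sample_prob mdl m (W n \<omega>) (black_balls b m B0 K n \<omega>) k"
      using process assms by (simp add: urn_process_def)
    with AE_space show "AE \<omega> in M. indicator {w} (W n \<omega>) * real_cond_exp M ?F ?g \<omega> =
        indicator {w} (W n \<omega>) * draw_prob n (W n \<omega>) k"
      by eventually_elim (simp add: draw_prob_def black_balls_eq)
  qed simp_all
  ultimately show ?thesis by simp
qed

text \<open>Expanding over the finitely many values of the content and of the sample reduces this to
  \<open>expectation_indicators\<close>. Vector values cover both real moments and complex
  characteristic functions.\<close>

lemma expectation_step:
  fixes f :: "int \<Rightarrow> nat \<Rightarrow> 'b :: {banach, second_countable_topology}"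
  shows "(\<integral>\<omega>. f (W n \<omega>) (K (Suc n) \<omega>) \<partial>M) =
    (\<integral>\<omega>. (\<Sum>k\<le>m. draw_prob n (W n \<omega>) k *\<^sub>R f (W n \<omega>) k) \<partial>M)"
proof -
  let ?S = "W n ` space M"
  have W_sum: "h (W n \<omega>) = (\<Sum>w\<in>?S. indicator {w} (W n \<omega>) *\<^sub>R h w)"
    if "\<omega> \<in> space M" for h :: "int \<Rightarrow> 'b" and \<omega>
  proof -
    have "(\<Sum>w\<in>?S. indicator {w} (W n \<omega>) *\<^sub>R h w) = (\<Sum>w\<in>?S. if W n \<omega> = w then h w else 0)"
      by (intro sum.cong) (auto simp: indicator_def)
    thus ?thesis using that finite_W by simp
  qed
  have K_sum: "f (W n \<omega>) (K (Suc n) \<omega>) = (\<Sum>k\<le>m. indicator {k} (K (Suc n) \<omega>) *\<^sub>R f (W n \<omega>) k)"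
    if "\<omega> \<in> space M" for \<omega>
  proof -
    have "(\<Sum>k\<le>m. indicator {k} (K (Suc n) \<omega>) *\<^sub>R f (W n \<omega>) k) =
        (\<Sum>k\<le>m. if K (Suc n) \<omega> = k then f (W n \<omega>) k else 0)"
      by (intro sum.cong) (auto simp: indicator_def)
    thus ?thesis using K_le[OF that] by simp
  qed
  have int: "integrable M (\<lambda>\<omega>. (indicator {w} (W n \<omega>) * indicator {k} (K (Suc n) \<omega>)) *\<^sub>R c)"
    for w k and c :: 'b
    by (intro integrable_scaleR_left integrable_const_bound[where B = 1]) (auto simp: indicator_def)
  have int_draw: "integrable M (\<lambda>\<omega>. (indicator {w} (W n \<omega>) * draw_prob n (W n \<omega>) k) *\<^sub>R c)"
    for w k and c :: 'b
    using integrable_W[of "\<lambda>v. (indicator {w} v * draw_prob n v k) *\<^sub>R c" n] by simp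
  have "(\<integral>\<omega>. f (W n \<omega>) (K (Suc n) \<omega>) \<partial>M) =
      (\<integral>\<omega>. (\<Sum>k\<le>m. \<Sum>w\<in>?S. (indicator {w} (W n \<omega>) * indicator {k} (K (Suc n) \<omega>)) *\<^sub>R f w k) \<partial>M)"
  proof (intro Bochner_Integration.integral_cong refl)
    fix \<omega> assume \<omega>: "\<omega> \<in> space M"
    show "f (W n \<omega>) (K (Suc n) \<omega>) =
       (\<Sum>k\<le>m. \<Sum>w\<in>?S. (indicator {w} (W n \<omega>) * indicator {k} (K (Suc n) \<omega>)) *\<^sub>R f w k)"
      unfolding K_sum[OF \<omega>]
      by (subst W_sum[OF \<omega>]) (simp add: scaleR_sum_right mult.commute)
  qed
  also have "\<dots> = (\<Sum>k\<le>m. \<Sum>w\<in>?S.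
      (\<integral>\<omega>. indicator {w} (W n \<omega>) * indicator {k} (K (Suc n) \<omega>) \<partial>M) *\<^sub>R f w k)"
    by (simp only: Bochner_Integration.integral_sum Bochner_Integration.integrable_sum int)
       (intro sum.cong refl Bochner_Integration.integral_scaleR_left integrable_const_bound[where B
           = 1],
         auto simp: indicator_def)
  also have "\<dots> = (\<Sum>k\<le>m. \<Sum>w\<in>?S.
      (\<integral>\<omega>. (indicator {w} (W n \<omega>) * draw_prob n (W n \<omega>) k) *\<^sub>R f w k \<partial>M))"
  proof (intro sum.cong refl)
    fix k w assume "k \<in> {..m}"
    thus "(\<integral>\<omega>. indicator {w} (W n \<omega>) * indicator {k} (K (Suc n) \<omega>) \<partial>M) *\<^sub>R f w k =
        (\<integral>\<omega>. (indicator {w} (W n \<omega>) * draw_prob n (W n \<omega>) k) *\<^sub>R f w k \<partial>M)"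
      using integrable_W[of "\<lambda>v. indicator {w} v * draw_prob n v k" n]
      by (simp add: expectation_indicators)
  qed
  also have "\<dots> = (\<integral>\<omega>. (\<Sum>k\<le>m. \<Sum>w\<in>?S. (indicator {w} (W n \<omega>) * draw_prob n (W n \<omega>) k) *\<^sub>R f w k) \<partial>M)"
    by (simp only: Bochner_Integration.integral_sum Bochner_Integration.integrable_sum int_draw)
  also have "\<dots> = (\<integral>\<omega>. (\<Sum>k\<le>m. draw_prob n (W n \<omega>) k *\<^sub>R f (W n \<omega>) k) \<partial>M)"
  proof (intro Bochner_Integration.integral_cong sum.cong refl)
    fix \<omega> k assume \<omega>: "\<omega> \<in> space M"
    show "(\<Sum>w\<in>?S. (indicator {w} (W n \<omega>) * draw_prob n (W n \<omega>) k) *\<^sub>R f w k) =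
        draw_prob n (W n \<omega>) k *\<^sub>R f (W n \<omega>) k"
      by (subst (2) W_sum[OF \<omega>]) (simp add: scaleR_sum_right mult.commute)
  qed
  finally show ?thesis .
qed

lemma expectation_Suc:
  fixes f :: "int \<Rightarrow> 'b :: {banach, second_countable_topology}"
  shows "(\<integral>\<omega>. f (W (Suc n) \<omega>) \<partial>M) =
    (\<integral>\<omega>. (\<Sum>k\<le>m. draw_prob n (W n \<omega>) k *\<^sub>R f (W n \<omega> + a m + d * int k)) \<partial>M)"
proof -
  have "(\<integral>\<omega>. f (W (Suc n) \<omega>) \<partial>M) = (\<integral>\<omega>. f (W n \<omega> + a m + d * int (K (Suc n) \<omega>)) \<partial>M)"
    by (intro Bochner_Integration.integral_cong refl) (simp add: W_Suc del: white_balls.simps)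
  thus ?thesis using expectation_step[of "\<lambda>w k. f (w + a m + d * int k)"] by simp
qed

text \<open>A draw of nonzero probability shows balls that are present. Without replacement the
  sampled balls all lie in the urn, and no more than these are removed; with replacement at most one
  ball of each colour is removed, and only of a colour seen in the sample.\<close>

lemma tenable_step:
  assumes w: "0 \<le> w" "w \<le> T n" and k: "k \<le> m" and nz: "draw_prob n w k \<noteq> 0"
  shows "0 \<le> w + a m + d * int k" "w + a m + d * int k \<le> T (Suc n)"
proof -
  have "0 \<le> w + a (m - k) \<and> 0 \<le> T n - w + b (m - k)"
  proof (cases mdl)
    case Model_M
    have "int k \<le> w" "int (m - k) \<le> T n - w"
      using nz[unfolded draw_prob_def] w by (auto simp: Model_M binomial_eq_0_iff)
    moreover have "a (m - k) \<ge> - int k" "b (m - k) \<ge> - int (m - k)"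
      using tenable k by (auto simp: Model_M of_nat_diff dest: spec[of _ "m - k"])
    ultimately show ?thesis by linarith
  next
    case Model_R
    \<comment> \<open>By \<open>0 ^ 0 = 1\<close>, an absent colour still allows samples made of the
      other colour alone.\<close>
    have nz': "k = 0 \<or> w \<ge> 1" "k = m \<or> T n - w \<ge> 1"
      using nz[unfolded draw_prob_def] w k by (auto simp: Model_R power_0_left split: if_splits)
    have "a (m - k) \<ge> (if k = 0 then 0 else -1)" "b (m - k) \<ge> (if k = m then 0 else -1)"
      using tenable k m_pos by (auto simp: Model_R)
    thus ?thesis using nz' w by (auto split: if_splits)
  qed
  thus "0 \<le> w + a m + d * int k" "w + a m + d * int k \<le> T (Suc n)"
    using a_plus_b[OF k] by (auto simp: a_eq[OF k] T_Suc)
qed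

text \<open>The expectation of the indicator \<open>bad\<close> of an impossible content stays 0: in
  each summand either the draw has probability 0 or the successor is valid.\<close>

lemma AE_W: "AE \<omega> in M. 0 \<le> W n \<omega> \<and> W n \<omega> \<le> T n"
proof (induction n)
  case 0 thus ?case by (simp add: T_def)
next
  case (Suc n)
  define bad :: "int \<Rightarrow> real" where "bad w = (if 0 \<le> w \<and> w \<le> T (Suc n) then 0 else 1)" for w
  have "(\<integral>\<omega>. bad (W (Suc n) \<omega>) \<partial>M) =
      (\<integral>\<omega>. (\<Sum>k\<le>m. draw_prob n (W n \<omega>) k *\<^sub>R bad (W n \<omega> + a m + d * int k)) \<partial>M)"
    by (rule expectation_Suc)
  also have "\<dots> = (\<integral>\<omega>. 0 \<partial>M)"
  proof (rule integral_cong_AE)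
    show "AE \<omega> in M. (\<Sum>k\<le>m. draw_prob n (W n \<omega>) k *\<^sub>R bad (W n \<omega> + a m + d * int k)) = 0"
      using Suc.IH
    proof eventually_elim
      case (elim \<omega>)
      show ?case
        using tenable_step[of "W n \<omega>" n] elim by (intro sum.neutral) (auto simp: bad_def)
    qed
  qed simp_all
  finally have "(\<integral>\<omega>. bad (W (Suc n) \<omega>) \<partial>M) = 0" by simp
  moreover have "AE \<omega> in M. 0 \<le> bad (W (Suc n) \<omega>)"
    by (auto simp: bad_def)
  ultimately have "AE \<omega> in M. bad (W (Suc n) \<omega>) = 0"
    using integral_nonneg_eq_0_iff_AE[OF integrable_W] by blast
  thus ?case by eventually_elim (auto simp: bad_def split: if_splits)
qed

end

section \<open>Characteristic functions\<close>

primrec linear_recursion :: "real \<Rightarrow> (nat \<Rightarrow> real) \<Rightarrow> (nat \<Rightarrow> real) \<Rightarrow> nat \<Rightarrow> real" where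
  "linear_recursion c G y 0 = c"
| "linear_recursion c G y (Suc n) = G n * linear_recursion c G y n + y n"

text \<open>The third power matches the Taylor remainder of \<open>iexp_second_order\<close>. For
  \<open>r \<le> 1\<close> use \<open>exp (- r\<^sup>2) \<le> 1 / (1 + r\<^sup>2)\<close>; for
  \<open>r > 1\<close> use \<open>exp (- r\<^sup>2) \<le> 1\<close> and
  \<open>r\<^sup>2 \<le> r ^ 3\<close>.\<close>

lemma exp_minus_square_approx:
  fixes r :: real
  assumes "0 \<le> r"
  shows "\<bar>exp (- r\<^sup>2) - (1 - r\<^sup>2)\<bar> \<le> r ^ 3"
proof -
  have lower: "1 - r\<^sup>2 \<le> exp (- r\<^sup>2)"
    using exp_ge_add_one_self[of "- r\<^sup>2"] by simp
  have "exp (- r\<^sup>2) \<le> 1 - r\<^sup>2 + r ^ 3"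
  proof (cases "r \<le> 1")
    case True
    have "exp (- r\<^sup>2) * (1 + r\<^sup>2) \<le> exp (- r\<^sup>2) * exp (r\<^sup>2)"
      using exp_ge_add_one_self[of "r\<^sup>2"] by (intro mult_left_mono) auto
    also have "\<dots> = 1" by (simp add: exp_minus)
    finally have "exp (- r\<^sup>2) \<le> 1 / (1 + r\<^sup>2)"
      by (simp add: pos_le_divide_eq add_pos_nonneg)
    also have "\<dots> \<le> 1 - r\<^sup>2 + r ^ 4"
    proof -
      have "(1 - r\<^sup>2 + r ^ 4) * (1 + r\<^sup>2) = 1 + r ^ 6" by algebra
      thus ?thesis by (subst pos_divide_le_eq) (auto simp: add_pos_nonneg)
    qed
    also have "r ^ 4 \<le> r ^ 3" using True assms by (intro power_decreasing) auto
    finally show ?thesis by simp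
  next
    case False
    hence "r\<^sup>2 \<le> r ^ 3" by (intro power_increasing) auto
    moreover have "exp (- r\<^sup>2) \<le> 1" by simp
    ultimately show ?thesis by linarith
  qed
  with lower show ?thesis using assms by simp
qed

lemma char_normal_law:
  assumes "0 < s"
  shows "real_distribution (normal_law 0 s)"
    and "char (normal_law 0 s) t = complex_of_real (exp (- t\<^sup>2 * s / 2))"
proof -
  interpret N: real_distribution std_normal_distribution by (rule real_dist_normal_dist)
  have "distributed std_normal_distribution lborel (\<lambda>x. x) std_normal_density"
    by (auto simp: distributed_def distr_id2)
  from N.normal_density_affine[OF this, of "sqrt s" 0]
  have "distributed std_normal_distribution lborel (\<lambda>x. sqrt s * x) (normal_density 0 (sqrt s))"
    using assms by simp
  hence "distr std_normal_distribution lborel (\<lambda>x. sqrt s * x) = normal_law 0 s"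
    by (simp add: distributed_distr_eq_density normal_law_def)
  moreover have "distr std_normal_distribution lborel (\<lambda>x. sqrt s * x) =
      distr std_normal_distribution borel (\<lambda>x. sqrt s * x)"
    by (rule distr_cong) auto
  ultimately have eq: "normal_law 0 s = distr std_normal_distribution borel (\<lambda>x. sqrt s * x)"
      by simp
  show "real_distribution (normal_law 0 s)"
    unfolding eq by (intro N.real_distribution_distr) simp
  have "char (normal_law 0 s) t = char std_normal_distribution (t * sqrt s)"
    unfolding eq char_def by (subst integral_distr) (auto simp: mult_ac)
  thus "char (normal_law 0 s) t = complex_of_real (exp (- t\<^sup>2 * s / 2))"
    using assms by (simp add: char_std_normal_distribution power_mult_distrib)
qed

lemma iexp_minus_1_bound: "cmod (iexp x - 1) \<le> \<bar>x\<bar>"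
  using iexp_approx1[of x 0] by simp

lemma iexp_second_order: "cmod (iexp x - (1 + \<i> * x - x\<^sup>2 / 2)) \<le> \<bar>x\<bar> ^ 3 / 6"
  using iexp_approx1[of x 2]
  by (simp add: eval_nat_numeral fact_numeral power_mult_distrib algebra_simps)

locale nondegenerate_urn = affine_urn_process +
  fixes \<Lambda> :: real
  assumes \<Lambda>_def: "\<Lambda> = urn_index m a \<sigma>"
    and index_le: "\<Lambda> \<le> 1/2" and index_nz: "\<Lambda> \<noteq> 0"
    and initial_pos: "int (W0 + B0) + int m * (a (m - 1) - a m) > 0"
    and a_nz: "a m \<noteq> 0" and b_nz: "b 0 \<noteq> 0"
begin

text \<open>The equilibrium proportion of white balls: it solves
  \<open>a m + m * d * p = \<sigma> * p\<close>.\<close>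

definition p :: real where "p = of_int (a m) / (of_int \<sigma> * (1 - \<Lambda>))"

definition G :: "nat \<Rightarrow> real" where "G n = 1 + real m * of_int d / of_int (T n)"

definition dev :: "nat \<Rightarrow> int \<Rightarrow> real" where "dev n w = of_int w - p * of_int (T n)"

text \<open>The conditional mean of the number of white balls in a sample from content
  \<open>w\<close>; \<open>var\<close> is the corresponding conditional variance.\<close>

definition mean :: "nat \<Rightarrow> int \<Rightarrow> real" where "mean n w = real m * of_int w / of_int (T n)"

definition var :: "nat \<Rightarrow> int \<Rightarrow> real" where
  "var n w = (\<Sum>k\<le>m. (real k - mean n w)\<^sup>2 * draw_prob n w k)"

text \<open>The limiting conditional variance of the increments: \<open>d\<^sup>2\<close> times the
  variance of a binomial count with parameters \<open>m\<close> and \<open>p\<close>.\<close>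

definition v :: real where "v = (of_int d)\<^sup>2 * (real m * p * (1 - p))"

definition D :: real where "D = real m * \<bar>of_int d\<bar>"

lemma T_real_ge: "1 \<le> real_of_int (T n)"
  using T_ge(2)[of n] by simp

lemma index_mult: "\<Lambda> * of_int \<sigma> = real m * of_int d"
  using \<sigma>_pos by (simp add: \<Lambda>_def urn_index_def d_def)

lemma d_nz: "d \<noteq> 0"
  using index_nz index_mult \<sigma>_pos by auto

lemma p_mult: "p * (of_int \<sigma> * (1 - \<Lambda>)) = of_int (a m)"
  using \<sigma>_pos index_le by (simp add: p_def)

lemma b_0_eq: "real_of_int (b 0) = of_int \<sigma> * (1 - \<Lambda>) - of_int (a m)"
proof -
  have "b 0 = \<sigma> - a m - d * int m" using a_plus_b[of m] a_eq[of m] by simp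
  hence "real_of_int (b 0) = real_of_int (\<sigma> - a m - d * int m)" by (simp only:)
  thus ?thesis using index_mult by (simp add: algebra_simps)
qed

text \<open>In both models tenability forbids an all-black sample to remove white balls and an
  all-white sample to remove black ones. Nontriangularity then gives strict signs, which put
  \<open>p\<close> strictly between 0 and 1.\<close>

lemma a_pos: "0 < a m" and b_pos: "0 < b 0"
  using tenable a_nz b_nz by (cases mdl; force)+

lemma p_pos: "0 < p" and p_less: "p < 1"
proof -
  have *: "0 < of_int \<sigma> * (1 - \<Lambda>)" using \<sigma>_pos index_le by simp
  show "0 < p" using * a_pos by (simp add: p_def)
  show "p < 1" using * b_pos b_0_eq by (simp add: p_def)
qed

lemma one_minus_p: "(1 - p) * (of_int \<sigma> * (1 - \<Lambda>)) = of_int (b 0)"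
  using p_mult b_0_eq by (simp add: algebra_simps)

lemma v_pos: "0 < v"
  using d_nz m_pos p_pos p_less by (simp add: v_def)

text \<open>Here \<open>m d = \<Lambda> \<sigma>\<close>, while \<open>p\<close> and
  \<open>1 - p\<close> are \<open>a m\<close> and \<open>b 0\<close> divided by
  \<open>\<sigma> (1 - \<Lambda>)\<close>.\<close>

lemma v_eq: "v = of_int (a m) * of_int (b 0) * \<Lambda>\<^sup>2 / (real m * (1 - \<Lambda>)\<^sup>2)"
proof -
  have "v * (real m * (1 - \<Lambda>)\<^sup>2) = (real m * of_int d)\<^sup>2 * (1 - \<Lambda>)\<^sup>2 * p * (1 - p)"
    by (simp add: v_def power2_eq_square)
  also have "\<dots> = \<Lambda>\<^sup>2 * (p * (of_int \<sigma> * (1 - \<Lambda>))) * ((1 - p) * (of_int \<sigma> * (1 - \<Lambda>)))"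
    unfolding index_mult[symmetric] by (simp add: power2_eq_square)
  finally show ?thesis unfolding p_mult one_minus_p
    using m_pos index_le by (simp add: field_simps)
qed

text \<open>Since \<open>T n \<ge> T 0\<close>, the assumption on the initial size covers all
  \<open>n\<close>, also for negative \<open>d\<close>. The sign allows
  \<open>\<bar>G n * t\<bar>\<close> to be written as \<open>G n * \<bar>t\<bar>\<close> in the
  error recursion.\<close>

lemma G_nonneg: "0 \<le> G n"
proof -
  have "0 \<le> \<sigma> * int n" using \<sigma>_pos by simp
  hence "0 < T n + int m * d" using initial_pos by (simp add: T_def d_def)
  hence "0 < real_of_int (T n) + real m * of_int d"
      by (metis of_int_0_less_iff of_int_add of_int_mult of_int_of_nat_eq)
  thus ?thesis using T_real_ge[of n] by (simp add: G_def field_simps)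
qed

lemma G_eq: "G n = 1 + \<Lambda> / (real n + real (W0 + B0) / of_int \<sigma>)"
proof -
  have "real_of_int (T n) = of_int \<sigma> * (real n + real (W0 + B0) / of_int \<sigma>)"
    using \<sigma>_pos by (simp add: T_def field_simps)
  thus ?thesis unfolding G_def index_mult[symmetric] using \<sigma>_pos by simp
qed

text \<open>The line \<open>p T\<^sub>n\<close> is a trajectory of the mean dynamics; centring at it instead of at the
  expectation makes the recursion homogeneous up to a martingale increment.\<close>

lemma dev_Suc:
  "dev (Suc n) (w + a m + d * int k) = G n * dev n w + of_int d * (real k - mean n w)"
proof -
  have T: "real_of_int (T n) \<noteq> 0" using T_real_ge[of n] by simp
  have "real_of_int (a m) = p * of_int \<sigma> - p * (real m * of_int d)"
    using p_mult index_mult by (simp add: algebra_simps)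
  moreover have "G n * dev n w =
      dev n w + real m * of_int d * of_int w / of_int (T n) - p * (real m * of_int d)"
    using T by (simp add: G_def dev_def field_simps)
  ultimately show ?thesis by (simp add: dev_def T_Suc mean_def algebra_simps)
qed

section \<open>One-step estimates from a fixed content of the urn\<close>

context
  fixes n :: nat and w :: int
  assumes w: "0 \<le> w" "w \<le> T n"
begin

lemma draw_prob_nonneg: "0 \<le> draw_prob n w k"
  unfolding draw_prob_def using w m_pos T_ge[of n] by (intro sample_prob_nonneg) auto

lemma sum_draw_prob: "(\<Sum>k\<le>m. draw_prob n w k) = 1"
  unfolding draw_prob_def using w m_pos T_ge[of n] by (intro sum_sample_prob) auto

lemma sum_draw_prob_centred: "(\<Sum>k\<le>m. draw_prob n w k * (real k - mean n w)) = 0"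
proof -
  have "(\<Sum>k\<le>m. real k * draw_prob n w k) = mean n w"
    unfolding draw_prob_def mean_def using w m_pos T_ge[of n] by (intro sample_prob_mean) auto
  moreover have "(\<Sum>k\<le>m. draw_prob n w k * (real k - mean n w)) =
      (\<Sum>k\<le>m. real k * draw_prob n w k - mean n w * draw_prob n w k)"
    by (intro sum.cong refl) (simp add: algebra_simps)
  ultimately show ?thesis
    by (simp add: sum_subtractf sum_distrib_left[symmetric] sum_draw_prob)
qed

lemma mean_bounds: "0 \<le> mean n w" "mean n w \<le> real m"
  using w T_real_ge[of n] m_pos by (auto simp: mean_def field_simps)

lemma abs_centred_le: "k \<le> m \<Longrightarrow> \<bar>real k - mean n w\<bar> \<le> real m"
  using mean_bounds by linarith

lemma var_le: "var n w \<le> (real m)\<^sup>2"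
proof -
  have "var n w \<le> (\<Sum>k\<le>m. (real m)\<^sup>2 * draw_prob n w k)"
    unfolding var_def using abs_centred_le
    by (intro sum_mono mult_right_mono draw_prob_nonneg) (auto simp: abs_le_square_iff[symmetric])
  thus ?thesis by (simp add: sum_distrib_left[symmetric] sum_draw_prob)
qed

text \<open>The sample variance is close to \<open>m x (1 - x)\<close> with
  \<open>x = w / T n\<close>. Moreover \<open>x (1 - x) - p (1 - p) = (x - p) (1 - x - p)\<close>,
  where the last factor is at most 1 in absolute value and
  \<open>x - p = dev n w / T n\<close>.\<close>

lemma var_approx:
  "\<bar>(of_int d)\<^sup>2 * var n w - v\<bar> \<le> (of_int d)\<^sup>2 * (2 * (real m)\<^sup>2 + real m * \<bar>dev n w\<bar>) / of_int (T n)"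
proof -
  define t where "t = real_of_int (T n)"
  have t: "t \<ge> 1" using T_real_ge by (simp add: t_def)
  define x where "x = real_of_int w / t"
  have x: "0 \<le> x" "x \<le> 1" using w t by (auto simp: x_def t_def)
  have "\<bar>var n w - real m * x * (1 - x)\<bar> \<le> 2 * (real m)\<^sup>2 / t"
    unfolding var_def draw_prob_def mean_def x_def t_def using w m_pos T_ge[of n]
    by (intro sample_prob_variance) auto
  moreover have "\<bar>real m * x * (1 - x) - real m * p * (1 - p)\<bar> \<le> real m * \<bar>dev n w\<bar> / t"
  proof -
    have "real m * x * (1 - x) - real m * p * (1 - p) = real m * (x - p) * (1 - x - p)"
      by algebra
    hence "\<bar>real m * x * (1 - x) - real m * p * (1 - p)\<bar> = real m * \<bar>x - p\<bar> * \<bar>1 - x - p\<bar>"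
      by (simp add: abs_mult)
    also have "\<dots> \<le> real m * \<bar>x - p\<bar> * 1"
      using x p_pos p_less by (intro mult_left_mono) auto
    also have "x - p = dev n w / t" using t by (simp add: x_def dev_def t_def field_simps)
    finally show ?thesis using t by simp
  qed
  ultimately have "\<bar>var n w - real m * p * (1 - p)\<bar> \<le> (2 * (real m)\<^sup>2 + real m * \<bar>dev n w\<bar>) / t"
    by (simp add: add_divide_distrib)
  hence "(of_int d)\<^sup>2 * \<bar>var n w - real m * p * (1 - p)\<bar> \<le>
      (of_int d)\<^sup>2 * ((2 * (real m)\<^sup>2 + real m * \<bar>dev n w\<bar>) / t)"
    by (intro mult_left_mono) auto
  moreover have "\<bar>(of_int d)\<^sup>2 * var n w - v\<bar> = (of_int d)\<^sup>2 * \<bar>var n w - real m * p * (1 - p)\<bar>"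
    by (simp add: v_def abs_mult right_diff_distrib[symmetric])
  ultimately show ?thesis by (simp add: t_def)
qed

text \<open>The cross term vanishes because the increment is conditionally centred.\<close>

lemma second_moment_step:
  "(\<Sum>k\<le>m. draw_prob n w k * (dev (Suc n) (w + a m + d * int k))\<^sup>2) \<le> (G n)\<^sup>2 * (dev n w)\<^sup>2 + D\<^sup>2"
proof -
  have "(\<Sum>k\<le>m. draw_prob n w k * (dev (Suc n) (w + a m + d * int k))\<^sup>2) =
      (\<Sum>k\<le>m. (G n)\<^sup>2 * (dev n w)\<^sup>2 * draw_prob n w k
        + 2 * G n * dev n w * of_int d * (draw_prob n w k * (real k - mean n w))
        + (of_int d)\<^sup>2 * ((real k - mean n w)\<^sup>2 * draw_prob n w k))"
    by (intro sum.cong refl) (simp only: dev_Suc, algebra)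
  also have "\<dots> = (G n)\<^sup>2 * (dev n w)\<^sup>2 + (of_int d)\<^sup>2 * var n w"
    by (simp add: sum.distrib sum_distrib_left[symmetric] sum_draw_prob sum_draw_prob_centred
        var_def)
  also have "(of_int d)\<^sup>2 * var n w \<le> D\<^sup>2"
    using mult_left_mono[OF var_le, of "(of_int d)\<^sup>2"]
    by (simp add: D_def power_mult_distrib mult.commute)
  finally show ?thesis by simp
qed

text \<open>Three comparisons are chained: the second-order Taylor expansion, whose linear term
  vanishes by centring; the replacement of the conditional variance by \<open>v\<close>; and the
  replacement of \<open>1 - t\<^sup>2 * v / 2\<close> by the Gaussian factor.\<close>

lemma char_step:
  "cmod ((\<Sum>k\<le>m. draw_prob n w k *\<^sub>R iexp (t * (of_int d * (real k - mean n w)))) -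
      exp (- t\<^sup>2 * v / 2)) \<le>
     t\<^sup>2 / 2 * \<bar>(of_int d)\<^sup>2 * var n w - v\<bar> + \<bar>t\<bar> ^ 3 * (D ^ 3 / 6 + sqrt (v / 2) ^ 3)"
proof -
  define y where "y k = t * (of_int d * (real k - mean n w))" for k
  have y: "\<bar>y k\<bar> \<le> \<bar>t\<bar> * D" if "k \<le> m" for k
  proof -
    have "\<bar>y k\<bar> = \<bar>t\<bar> * (\<bar>of_int d\<bar> * \<bar>real k - mean n w\<bar>)" by (simp add: y_def abs_mult)
    also have "\<dots> \<le> \<bar>t\<bar> * (\<bar>of_int d\<bar> * real m)"
      using abs_centred_le[OF that] by (intro mult_left_mono) auto
    finally show ?thesis by (simp add: D_def mult.commute)
  qed
  have "(\<Sum>k\<le>m. draw_prob n w k *\<^sub>R (1 + \<i> * y k - (y k)\<^sup>2 / 2)) =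
      (\<Sum>k\<le>m. complex_of_real (draw_prob n w k) +
          \<i> * t * of_int d * complex_of_real (draw_prob n w k * (real k - mean n w))
        - complex_of_real (t\<^sup>2 * (of_int d)\<^sup>2 / 2 * ((real k - mean n w)\<^sup>2 * draw_prob n w k)))"
    by (intro sum.cong refl) (simp add: y_def scaleR_conv_of_real power2_eq_square field_simps)
  also have "\<dots> = complex_of_real (\<Sum>k\<le>m. draw_prob n w k)
      + \<i> * t * of_int d * complex_of_real (\<Sum>k\<le>m. draw_prob n w k * (real k - mean n w))
      - complex_of_real (t\<^sup>2 * (of_int d)\<^sup>2 / 2 * var n w)"
    by (simp only: sum.distrib sum_subtractf sum_distrib_left[symmetric] of_real_sum[symmetric]
        var_def)
  finally have taylor: "(\<Sum>k\<le>m. draw_prob n w k *\<^sub>R (1 + \<i> * y k - (y k)\<^sup>2 / 2)) =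
      complex_of_real (1 - t\<^sup>2 * (of_int d)\<^sup>2 / 2 * var n w)"
    by (simp add: sum_draw_prob sum_draw_prob_centred)
  have "cmod ((\<Sum>k\<le>m. draw_prob n w k *\<^sub>R iexp (y k)) -
      complex_of_real (1 - t\<^sup>2 * (of_int d)\<^sup>2 / 2 * var n w)) =
      cmod (\<Sum>k\<le>m. draw_prob n w k *\<^sub>R (iexp (y k) - (1 + \<i> * y k - (y k)\<^sup>2 / 2)))"
    unfolding taylor[symmetric] by (simp only: sum_subtractf[symmetric]
        scaleR_diff_right[symmetric])
  also have "\<dots> \<le> (\<Sum>k\<le>m. draw_prob n w k * ((\<bar>t\<bar> * D) ^ 3 / 6))"
  proof (intro sum_norm_le)
    fix k assume "k \<in> {..m}"
    hence "\<bar>y k\<bar> ^ 3 \<le> (\<bar>t\<bar> * D) ^ 3" using y by (intro power_mono) auto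
    hence "cmod (iexp (y k) - (1 + \<i> * y k - (y k)\<^sup>2 / 2)) \<le> (\<bar>t\<bar> * D) ^ 3 / 6"
      using iexp_second_order[of "y k"] by linarith
    from mult_left_mono[OF this draw_prob_nonneg[of k]]
    show "norm (draw_prob n w k *\<^sub>R (iexp (y k) - (1 + \<i> * y k - (y k)\<^sup>2 / 2))) \<le>
        draw_prob n w k * ((\<bar>t\<bar> * D) ^ 3 / 6)"
      using draw_prob_nonneg[of k] by simp
  qed
  also have "\<dots> = \<bar>t\<bar> ^ 3 * (D ^ 3 / 6)"
    by (subst sum_distrib_right[symmetric]) (simp add: sum_draw_prob power_mult_distrib)
  finally have 1: "cmod ((\<Sum>k\<le>m. draw_prob n w k *\<^sub>R iexp (y k)) -
      complex_of_real (1 - t\<^sup>2 * (of_int d)\<^sup>2 / 2 * var n w))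
      \<le> \<bar>t\<bar> ^ 3 * (D ^ 3 / 6)" .
  have 2: "cmod (complex_of_real (1 - t\<^sup>2 * (of_int d)\<^sup>2 / 2 * var n w) -
      complex_of_real (1 - t\<^sup>2 * v / 2)) = t\<^sup>2 / 2 * \<bar>(of_int d)\<^sup>2 * var n w - v\<bar>"
  proof -
    have "(1 - t\<^sup>2 * (of_int d)\<^sup>2 / 2 * var n w) - (1 - t\<^sup>2 * v / 2) =
        - (t\<^sup>2 / 2 * ((of_int d)\<^sup>2 * var n w - v))" by (simp add: field_simps)
    thus ?thesis unfolding of_real_diff[symmetric] norm_of_real by (simp add: abs_mult)
  qed
  have 3: "cmod (complex_of_real (1 - t\<^sup>2 * v / 2) - exp (- t\<^sup>2 * v / 2)) \<le>
      \<bar>t\<bar> ^ 3 * sqrt (v / 2) ^ 3"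
  proof -
    have "(\<bar>t\<bar> * sqrt (v / 2))\<^sup>2 = t\<^sup>2 * v / 2" using v_pos by (simp add: power_mult_distrib)
    with exp_minus_square_approx[of "\<bar>t\<bar> * sqrt (v / 2)"] v_pos
    have "\<bar>(1 - t\<^sup>2 * v / 2) - exp (- t\<^sup>2 * v / 2)\<bar> \<le> \<bar>t\<bar> ^ 3 * sqrt (v / 2) ^ 3"
      by (simp add: power_mult_distrib abs_minus_commute)
    thus ?thesis unfolding of_real_diff[symmetric] norm_of_real .
  qed
  show ?thesis
    using norm_diff_triangle_le[OF 1 norm_diff_triangle_le[OF eq_refl[OF 2] 3]]
    by (simp add: y_def distrib_left)
qed

end

section \<open>Recursion for the characteristic functions and accumulation of errors\<close>

definition Q :: "nat \<Rightarrow> real" where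
  "Q = linear_recursion ((dev 0 (int W0))\<^sup>2) (\<lambda>n. (G n)\<^sup>2) (\<lambda>_. D\<^sup>2)"

text \<open>Bounds half the mean distance of the conditional variance from \<open>v\<close>, by
  \<open>var_approx\<close> with \<open>sqrt (Q n)\<close> in place of the mean of
  \<open>\<bar>dev\<bar>\<close>.\<close>

definition err :: "nat \<Rightarrow> real" where
  "err n = (of_int d)\<^sup>2 * (2 * (real m)\<^sup>2 + real m * sqrt (Q n)) / of_int (T n) / 2"

definition C :: real where "C = D ^ 3 / 6 + sqrt (v / 2) ^ 3"

definition \<phi> :: "nat \<Rightarrow> real \<Rightarrow> complex" where
  "\<phi> n t = (\<integral>\<omega>. iexp (t * dev n (W n \<omega>)) \<partial>M)"

lemma second_moment_le: "(\<integral>\<omega>. (dev n (W n \<omega>))\<^sup>2 \<partial>M) \<le> Q n"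
proof (induction n)
  case 0
  thus ?case by (simp add: Q_def prob_space)
next
  case (Suc n)
  have "(\<integral>\<omega>. (dev (Suc n) (W (Suc n) \<omega>))\<^sup>2 \<partial>M) =
     (\<integral>\<omega>. (\<Sum>k\<le>m. draw_prob n (W n \<omega>) k * (dev (Suc n) (W n \<omega> + a m + d * int k))\<^sup>2) \<partial>M)"
    using expectation_Suc[of "\<lambda>w. (dev (Suc n) w)\<^sup>2" n] by simp
  also have "\<dots> \<le> (\<integral>\<omega>. (G n)\<^sup>2 * (dev n (W n \<omega>))\<^sup>2 + D\<^sup>2 \<partial>M)"
  proof (rule integral_mono_AE)
    show "integrable M (\<lambda>\<omega>. \<Sum>k\<le>m. draw_prob n (W n \<omega>) k * (dev (Suc n) (W n \<omega> + a m + d * int k))\<^sup>2)"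
      using integrable_W[of "\<lambda>w. \<Sum>k\<le>m. draw_prob n w k * (dev (Suc n) (w + a m + d * int k))\<^sup>2" n] .
    show "integrable M (\<lambda>\<omega>. (G n)\<^sup>2 * (dev n (W n \<omega>))\<^sup>2 + D\<^sup>2)"
      using integrable_W[of "\<lambda>w. (G n)\<^sup>2 * (dev n w)\<^sup>2 + D\<^sup>2" n] .
    show "AE \<omega> in M. (\<Sum>k\<le>m. draw_prob n (W n \<omega>) k * (dev (Suc n) (W n \<omega> + a m + d * int k))\<^sup>2) \<le>
        (G n)\<^sup>2 * (dev n (W n \<omega>))\<^sup>2 + D\<^sup>2"
      using AE_W[of n] by eventually_elim (auto intro: second_moment_step)
  qed
  also have "\<dots> = (G n)\<^sup>2 * (\<integral>\<omega>. (dev n (W n \<omega>))\<^sup>2 \<partial>M) + D\<^sup>2"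
    using integrable_W[of "\<lambda>w. (dev n w)\<^sup>2" n] by (simp add: prob_space)
  also have "\<dots> \<le> (G n)\<^sup>2 * Q n + D\<^sup>2"
    using Suc.IH by (intro add_right_mono mult_left_mono) auto
  also have "\<dots> = Q (Suc n)" by (simp add: Q_def)
  finally show ?case .
qed

text \<open>Cauchy-Schwarz, in the form that a variance is nonnegative.\<close>

lemma first_moment_le: "(\<integral>\<omega>. \<bar>dev n (W n \<omega>)\<bar> \<partial>M) \<le> sqrt (Q n)"
proof (rule real_le_rsqrt)
  have "integrable M (\<lambda>\<omega>. \<bar>dev n (W n \<omega>)\<bar>)" "integrable M (\<lambda>\<omega>. \<bar>dev n (W n \<omega>)\<bar>\<^sup>2)"
    using integrable_W[of "\<lambda>w. \<bar>dev n w\<bar>" n] integrable_W[of "\<lambda>w. \<bar>dev n w\<bar>\<^sup>2" n] by simp_all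
  from variance_eq[OF this] variance_positive[of "\<lambda>\<omega>. \<bar>dev n (W n \<omega>)\<bar>"]
  show "(\<integral>\<omega>. \<bar>dev n (W n \<omega>)\<bar> \<partial>M)\<^sup>2 \<le> Q n"
    using second_moment_le[of n] by simp
qed

text \<open>Conditioning on the first \<open>n\<close> draws splits off the unimodular factor
  \<open>iexp (G n * t * dev n (W n \<omega>))\<close> from the conditional characteristic function
  \<open>\<Theta>\<close> of the increment. Replacing \<open>\<Theta>\<close> by the Gaussian factor
  costs the average of the bound in \<open>char_step\<close>.\<close>

lemma \<phi>_Suc:
  "cmod (\<phi> (Suc n) t - \<phi> n (G n * t) * exp (- t\<^sup>2 * v / 2)) \<le> t\<^sup>2 * err n + \<bar>t\<bar> ^ 3 * C"
proof -
  define \<Theta> where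
    "\<Theta> w = (\<Sum>k\<le>m. draw_prob n w k *\<^sub>R iexp (t * (of_int d * (real k - mean n w))))" for w
  define e where "e = complex_of_real (exp (- t\<^sup>2 * v / 2))"
  define c :: real where "c = (of_int d)\<^sup>2 / of_int (T n)"
  have "c \<ge> 0" using T_real_ge[of n] by (simp add: c_def)
  have "\<phi> (Suc n) t = (\<integral>\<omega>. (\<Sum>k\<le>m. draw_prob n (W n \<omega>) k *\<^sub>R
      iexp (t * dev (Suc n) (W n \<omega> + a m + d * int k))) \<partial>M)"
    unfolding \<phi>_def by (rule expectation_Suc)
  also have "\<dots> = (\<integral>\<omega>. iexp (G n * t * dev n (W n \<omega>)) * \<Theta> (W n \<omega>) \<partial>M)"
    unfolding \<Theta>_def dev_Suc sum_distrib_left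
    by (intro Bochner_Integration.integral_cong sum.cong refl)
       (simp add: exp_add[symmetric] algebra_simps)
  finally have "\<phi> (Suc n) t - \<phi> n (G n * t) * e =
      (\<integral>\<omega>. iexp (G n * t * dev n (W n \<omega>)) * \<Theta> (W n \<omega>) \<partial>M) -
          (\<integral>\<omega>. iexp (G n * t * dev n (W n \<omega>)) * e \<partial>M)"
    using integrable_W[of "\<lambda>w. iexp (G n * t * dev n w)" n] by (simp add: \<phi>_def)
  also have "\<dots> = (\<integral>\<omega>. iexp (G n * t * dev n (W n \<omega>)) * (\<Theta> (W n \<omega>) - e) \<partial>M)"
    using integrable_W[of "\<lambda>w. iexp (G n * t * dev n w) * \<Theta> w" n]
      integrable_W[of "\<lambda>w. iexp (G n * t * dev n w) * e" n]
    by (simp only: Bochner_Integration.integral_diff[symmetric] right_diff_distrib)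
  finally have "cmod (\<phi> (Suc n) t - \<phi> n (G n * t) * e) \<le>
      (\<integral>\<omega>. cmod (iexp (G n * t * dev n (W n \<omega>)) * (\<Theta> (W n \<omega>) - e)) \<partial>M)"
    by (simp only: integral_norm_bound)
  also have "\<dots> \<le> (\<integral>\<omega>. t\<^sup>2 / 2 * (c * (2 * (real m)\<^sup>2 + real m * \<bar>dev n (W n \<omega>)\<bar>)) + \<bar>t\<bar> ^ 3 * C \<partial>M)"
  proof (rule integral_mono_AE)
    show "integrable M (\<lambda>\<omega>. cmod (iexp (G n * t * dev n (W n \<omega>)) * (\<Theta> (W n \<omega>) - e)))"
      using integrable_W[of "\<lambda>w. cmod (iexp (G n * t * dev n w) * (\<Theta> w - e))" n] .
    show "integrable M (\<lambda>\<omega>. t\<^sup>2 / 2 * (c * (2 * (real m)\<^sup>2 + real m * \<bar>dev n (W n \<omega>)\<bar>)) +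
        \<bar>t\<bar> ^ 3 * C)"
      using integrable_W[of "\<lambda>w. t\<^sup>2 / 2 * (c * (2 * (real m)\<^sup>2 + real m * \<bar>dev n w\<bar>)) +
          \<bar>t\<bar> ^ 3 * C" n] .
    show "AE \<omega> in M. norm (iexp (G n * t * dev n (W n \<omega>)) * (\<Theta> (W n \<omega>) - e)) \<le>
        t\<^sup>2 / 2 * (c * (2 * (real m)\<^sup>2 + real m * \<bar>dev n (W n \<omega>)\<bar>)) + \<bar>t\<bar> ^ 3 * C"
      using AE_W[of n]
    proof eventually_elim
      case (elim \<omega>)
      have "norm (iexp (G n * t * dev n (W n \<omega>)) * (\<Theta> (W n \<omega>) - e)) = cmod (\<Theta> (W n \<omega>) - e)"
        by (simp add: norm_mult)
      also have "\<dots> \<le> t\<^sup>2 / 2 * \<bar>(of_int d)\<^sup>2 * var n (W n \<omega>) - v\<bar> + \<bar>t\<bar> ^ 3 * C"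
        unfolding \<Theta>_def e_def C_def using elim by (intro char_step) auto
      also have "\<dots> \<le> t\<^sup>2 / 2 * (c * (2 * (real m)\<^sup>2 + real m * \<bar>dev n (W n \<omega>)\<bar>)) + \<bar>t\<bar> ^ 3 * C"
        using var_approx[of "W n \<omega>" n] elim
        by (intro add_right_mono mult_left_mono) (auto simp: c_def)
      finally show ?case .
    qed
  qed
  also have "\<dots> = t\<^sup>2 / 2 * (c * (2 * (real m)\<^sup>2 + real m * (\<integral>\<omega>. \<bar>dev n (W n \<omega>)\<bar> \<partial>M))) + \<bar>t\<bar> ^ 3 * C"
    using integrable_W[of "\<lambda>w. \<bar>dev n w\<bar>" n] by (simp add: prob_space)
  also have "\<dots> \<le> t\<^sup>2 / 2 * (c * (2 * (real m)\<^sup>2 + real m * sqrt (Q n))) + \<bar>t\<bar> ^ 3 * C"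
    using first_moment_le[of n] \<open>c \<ge> 0\<close>
    by (intro add_right_mono mult_left_mono add_left_mono) auto
  also have "\<dots> = t\<^sup>2 * err n + \<bar>t\<bar> ^ 3 * C" by (simp add: err_def c_def)
  finally show ?thesis by (simp add: e_def)
qed

definition variance_rec :: "nat \<Rightarrow> real" where
  "variance_rec = linear_recursion 0 (\<lambda>n. (G n)\<^sup>2) (\<lambda>_. v)"

text \<open>\<open>err1\<close>, \<open>err2\<close>, \<open>err3\<close> are the coefficients of
  \<open>\<bar>t\<bar>\<close>, \<open>t\<^sup>2\<close>, \<open>\<bar>t\<bar> ^ 3\<close> in the
  error. Passing from \<open>t\<close> to \<open>G n * t\<close> multiplies the k-th one by
  \<open>G n ^ k\<close>. The start of \<open>err1\<close> comes from comparing
  \<open>\<phi> 0\<close> with the constant 1.\<close>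

definition err1 :: "nat \<Rightarrow> real" where
  "err1 = linear_recursion \<bar>dev 0 (int W0)\<bar> G (\<lambda>_. 0)"

definition err2 :: "nat \<Rightarrow> real" where
  "err2 = linear_recursion 0 (\<lambda>n. (G n)\<^sup>2) err"

definition err3 :: "nat \<Rightarrow> real" where
  "err3 = linear_recursion 0 (\<lambda>n. G n ^ 3) (\<lambda>_. C)"

text \<open>The induction keeps \<open>t\<close> arbitrary because the step uses the previous bound
  at \<open>G n * t\<close>. The Gaussian factor is at most 1 and does not enlarge earlier
  errors.\<close>

lemma \<phi>_approx:
  "cmod (\<phi> n t - exp (- t\<^sup>2 * variance_rec n / 2)) \<le> \<bar>t\<bar> * err1 n + t\<^sup>2 * err2 n + \<bar>t\<bar> ^ 3 * err3 n"
proof (induction n arbitrary: t)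
  case 0
  have "\<phi> 0 t = iexp (t * dev 0 (int W0))" by (simp add: \<phi>_def prob_space)
  thus ?case
    using iexp_minus_1_bound[of "t * dev 0 (int W0)"]
    by (simp add: variance_rec_def err1_def err2_def err3_def abs_mult)
next
  case (Suc n)
  let ?e = "exp (- t\<^sup>2 * v / 2)" and ?E = "exp (- (G n * t)\<^sup>2 * variance_rec n / 2)"
  have exp_eq: "exp (- t\<^sup>2 * variance_rec (Suc n) / 2) = ?E * ?e"
    by (simp add: variance_rec_def exp_add[symmetric] power_mult_distrib) (simp add: field_simps)
  have "?e \<le> 1" using v_pos by simp
  have "\<phi> n (G n * t) * ?e - ?E * ?e = (\<phi> n (G n * t) - ?E) * ?e"
    by (simp only: of_real_mult left_diff_distrib)
  hence "cmod (\<phi> n (G n * t) * ?e - ?E * ?e) = cmod (\<phi> n (G n * t) - ?E) * ?e"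
    by (simp only: norm_mult norm_of_real abs_exp_cancel)
  also have "\<dots> \<le> cmod (\<phi> n (G n * t) - ?E) * 1"
    using \<open>?e \<le> 1\<close> by (intro mult_left_mono) auto
  also have "\<dots> \<le> \<bar>G n * t\<bar> * err1 n + (G n * t)\<^sup>2 * err2 n + \<bar>G n * t\<bar> ^ 3 * err3 n"
    using Suc.IH[of "G n * t"] by simp
  finally have "cmod (\<phi> (Suc n) t - ?E * ?e) \<le> (t\<^sup>2 * err n + \<bar>t\<bar> ^ 3 * C) +
      (\<bar>G n * t\<bar> * err1 n + (G n * t)\<^sup>2 * err2 n + \<bar>G n * t\<bar> ^ 3 * err3 n)"
    using \<phi>_Suc[of n t] norm_diff_triangle_le by blast
  also have "\<dots> = \<bar>t\<bar> * err1 (Suc n) + t\<^sup>2 * err2 (Suc n) + \<bar>t\<bar> ^ 3 * err3 (Suc n)"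
    using G_nonneg[of n]
    by (simp add: err1_def err2_def err3_def abs_mult power_mult_distrib algebra_simps)
  finally show ?case unfolding exp_eq by simp
qed

text \<open>At \<open>t / sqrt (S n)\<close> the k-th error coefficient is divided by
  \<open>sqrt (S n) ^ k\<close>, and the quotient tends to 0. The condition on
  \<open>S n / (real n)\<^sup>2\<close> keeps the deviations small against \<open>T n\<close>, so
  that the conditional variance tends to \<open>v\<close> in mean.\<close>

lemma central_limit:
  assumes S: "recursion_scale G S \<kappa>" and S_small: "(\<lambda>n. S n / (real n)\<^sup>2) \<longlonglongrightarrow> 0"
  shows "weak_conv_m
    (\<lambda>n. distr M borel (\<lambda>\<omega>. (real_of_int (W n \<omega>) - of_int (a m) / (1 - \<Lambda>) * real n) / sqrt (S n)))
    (normal_law 0 (v / \<kappa>))"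
proof -
  interpret recursion_scale G S \<kappa> by (rule S)
  let ?X = "\<lambda>n \<omega>. (real_of_int (W n \<omega>) - of_int (a m) / (1 - \<Lambda>) * real n) / sqrt (S n)"
  \<comment> \<open>The centring in the statement is \<open>p * \<sigma> * n\<close>, which differs
    from \<open>p * T n\<close> by this constant; division by \<open>sqrt (S n)\<close> removes it
    in the limit.\<close>
  define x0 where "x0 = p * real (W0 + B0)"
  have S_inv: "(\<lambda>n. c / sqrt (S n)) \<longlonglongrightarrow> 0" for c
    by (intro tendsto_divide_0[OF tendsto_const] filterlim_at_top_imp_at_infinity
          filterlim_compose[OF sqrt_at_top] S_at_top)
  have X_eq: "?X n \<omega> = x0 / sqrt (S n) + dev n (W n \<omega>) / sqrt (S n)" for n \<omega>
  proof -
    have "of_int (a m) / (1 - \<Lambda>) = p * of_int \<sigma>"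
      using p_mult index_le by (simp add: field_simps)
    thus ?thesis by (simp add: dev_def T_def x0_def add_divide_distrib[symmetric] algebra_simps)
  qed
  have X_meas: "?X n \<in> borel_measurable M" for n
    using measurable_compose[OF W_measurable[of n], of "\<lambda>w. (real_of_int w - of_int (a m) / (1 -
        \<Lambda>) * real n) / sqrt (S n)" borel]
    by simp
  have char_X: "char (distr M borel (?X n)) t = iexp (t * (x0 / sqrt (S n))) * \<phi> n (t / sqrt (S n))"
      for n t
  proof -
    have "char (distr M borel (?X n)) t = (\<integral>\<omega>. iexp (t * ?X n \<omega>) \<partial>M)"
      unfolding char_def using X_meas by (subst integral_distr) auto
    also have "\<dots> = (\<integral>\<omega>. iexp (t * (x0 / sqrt (S n))) * iexp (t / sqrt (S n) * dev n (W n \<omega>)) \<partial>M)"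
      unfolding X_eq by (simp add: exp_add[symmetric] algebra_simps)
    finally show ?thesis
      using integrable_W[of "\<lambda>w. iexp (t / sqrt (S n) * dev n w)" n] by (simp add: \<phi>_def)
  qed
  have Q_lim: "(\<lambda>n. Q n / S n) \<longlonglongrightarrow> D\<^sup>2 / \<kappa>"
    by (rule recursion_ratio_2[where y = "\<lambda>_. D\<^sup>2"]) (simp_all add: Q_def)
  have T_lim: "(\<lambda>n. real n / of_int (T n)) \<longlonglongrightarrow> 1 / of_int \<sigma>"
    and T_lim': "(\<lambda>n. 1 / real_of_int (T n)) \<longlonglongrightarrow> 0"
  proof -
    have "0 < real_of_int \<sigma>" using \<sigma>_pos by simp
    hence "(\<lambda>n. real n / (real (W0 + B0) + of_int \<sigma> * real n)) \<longlonglongrightarrow> 1 / of_int \<sigma>"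
      "(\<lambda>n. 1 / (real (W0 + B0) + of_int \<sigma> * real n)) \<longlonglongrightarrow> 0"
      by (real_asymp simp: field_simps)+
    thus "(\<lambda>n. real n / of_int (T n)) \<longlonglongrightarrow> 1 / of_int \<sigma>"
      "(\<lambda>n. 1 / real_of_int (T n)) \<longlonglongrightarrow> 0"
      by (simp_all add: T_def)
  qed
  have err_lim: "err \<longlonglongrightarrow> 0"
  proof -
    \<comment> \<open>\<open>Q n\<close> is O(S n) and \<open>S n\<close> is o(n^2), so
      \<open>sqrt (Q n)\<close> is o(n) while \<open>T n\<close> grows linearly.\<close>
    have "(\<lambda>n. sqrt (Q n / S n * (S n / (real n)\<^sup>2)) * (real n / of_int (T n))) \<longlonglongrightarrow>
        sqrt (D\<^sup>2 / \<kappa> * 0) * (1 / of_int \<sigma>)"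
      by (intro tendsto_intros Q_lim S_small T_lim)
    moreover have "\<forall>\<^sub>F n in sequentially. sqrt (Q n / S n * (S n / (real n)\<^sup>2)) * (real n / of_int (T
        n)) =
        sqrt (Q n) / of_int (T n)"
      using S_pos eventually_gt_at_top[of 0]
      by eventually_elim (simp add: real_sqrt_divide)
    ultimately have "(\<lambda>n. sqrt (Q n) / of_int (T n)) \<longlonglongrightarrow> 0"
      by (simp add: Lim_transform_eventually)
    hence "(\<lambda>n. (of_int d)\<^sup>2 / 2 * (2 * (real m)\<^sup>2 * (1 / of_int (T n)) +
        real m * (sqrt (Q n) / of_int (T n)))) \<longlonglongrightarrow>
        (of_int d)\<^sup>2 / 2 * (2 * (real m)\<^sup>2 * 0 + real m * 0)"
      by (intro tendsto_intros T_lim')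
    thus ?thesis unfolding err_def by (simp add: algebra_simps add_divide_distrib)
  qed
  \<comment> \<open>On the scale \<open>S\<close> only the constant forcing \<open>v\<close>
    survives; the forcing \<open>err\<close> of \<open>err2\<close> tends to 0.\<close>
  have lims: "(\<lambda>n. variance_rec n / S n) \<longlonglongrightarrow> v / \<kappa>"
    "(\<lambda>n. err1 n / sqrt (S n)) \<longlonglongrightarrow> 0"
    "(\<lambda>n. err2 n / S n) \<longlonglongrightarrow> 0 / \<kappa>"
    "(\<lambda>n. err3 n / sqrt (S n) ^ 3) \<longlonglongrightarrow> 0"
    by (rule recursion_ratio_2[where y = "\<lambda>_. v"] recursion_ratio_1
          recursion_ratio_2[where y = err, OF _ err_lim] recursion_ratio_3[where c = C];
        simp add: variance_rec_def err1_def err2_def err3_def)+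
  show ?thesis
  proof (rule levy_continuity)
    show "real_distribution (distr M borel (?X n))" for n
      by (rule real_distribution_distr[OF X_meas])
    show "real_distribution (normal_law 0 (v / \<kappa>))"
      using v_pos \<kappa>_pos by (intro char_normal_law) simp
    fix t :: real
    have "(\<lambda>n. \<bar>t\<bar> * (err1 n / sqrt (S n)) + t\<^sup>2 * (err2 n / S n) +
        \<bar>t\<bar> ^ 3 * (err3 n / sqrt (S n) ^ 3)) \<longlonglongrightarrow>
        \<bar>t\<bar> * 0 + t\<^sup>2 * (0 / \<kappa>) + \<bar>t\<bar> ^ 3 * 0"
      by (intro tendsto_add tendsto_mult tendsto_const lims)
    hence bound_lim: "(\<lambda>n. \<bar>t\<bar> * (err1 n / sqrt (S n)) + t\<^sup>2 * (err2 n / S n) +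
        \<bar>t\<bar> ^ 3 * (err3 n / sqrt (S n) ^ 3)) \<longlonglongrightarrow> 0"
      by simp
    have bound: "\<forall>\<^sub>F n in sequentially.
        cmod (\<phi> n (t / sqrt (S n)) - exp (- t\<^sup>2 * (variance_rec n / S n) / 2)) \<le>
        \<bar>t\<bar> * (err1 n / sqrt (S n)) + t\<^sup>2 * (err2 n / S n) + \<bar>t\<bar> ^ 3 * (err3 n / sqrt (S n) ^ 3)"
      using S_pos
    proof eventually_elim
      case (elim n)
      show ?case using \<phi>_approx[of n "t / sqrt (S n)"] elim by (simp add: power_divide)
    qed
    have "(\<lambda>n. - t\<^sup>2 * (variance_rec n / S n) / 2) \<longlonglongrightarrow> - t\<^sup>2 * (v / \<kappa>) / 2"
      by (intro tendsto_mult tendsto_divide tendsto_const lims) simp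
    hence "(\<lambda>n. complex_of_real (exp (- t\<^sup>2 * (variance_rec n / S n) / 2))) \<longlonglongrightarrow>
        complex_of_real (exp (- t\<^sup>2 * (v / \<kappa>) / 2))"
      by (intro tendsto_of_real tendsto_exp)
    from tendsto_add[OF Lim_null_comparison[OF bound bound_lim] this]
    have "(\<lambda>n. \<phi> n (t / sqrt (S n))) \<longlonglongrightarrow> complex_of_real (exp (- t\<^sup>2 * (v / \<kappa>) / 2))"
      by simp
    moreover have "(\<lambda>n. iexp (t * (x0 / sqrt (S n)))) \<longlonglongrightarrow> iexp (t * 0)"
      by (intro tendsto_exp tendsto_mult tendsto_of_real tendsto_const S_inv)
    ultimately have "(\<lambda>n. iexp (t * (x0 / sqrt (S n))) * \<phi> n (t / sqrt (S n))) \<longlonglongrightarrow>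
        iexp (t * 0) * complex_of_real (exp (- t\<^sup>2 * (v / \<kappa>) / 2))"
      by (rule tendsto_mult[rotated])
    hence "(\<lambda>n. iexp (t * (x0 / sqrt (S n))) * \<phi> n (t / sqrt (S n))) \<longlonglongrightarrow>
        complex_of_real (exp (- t\<^sup>2 * (v / \<kappa>) / 2))"
      by simp
    moreover have "0 < v / \<kappa>" using v_pos \<kappa>_pos by simp
    ultimately show "(\<lambda>n. char (distr M borel (?X n)) t) \<longlonglongrightarrow> char (normal_law 0 (v / \<kappa>)) t"
      by (simp only: char_X char_normal_law(2))
  qed
qed

end

section \<open>The regimes of index below 1/2 and equal to 1/2\<close>

theorem theorem3:
  fixes mdl :: sampling_model
    and m W0 B0 :: nat
    and a b :: "nat \<Rightarrow> int"
    and \<sigma> :: int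
    and \<Lambda> :: real
    and M :: "'w measure"
    and K :: "nat \<Rightarrow> 'w \<Rightarrow> nat"
    and W :: "nat \<Rightarrow> 'w \<Rightarrow> int"
  assumes "m \<ge> 1" and "\<sigma> \<ge> 1" and "W0 + B0 \<ge> m"
    and "balanced_urn m a b \<sigma>"
    and "affine_urn m a"
    and "tenable mdl m a b"
    and "urn_process mdl m a b W0 B0 M K"
    and "W = white_balls a m W0 K"
    and "\<Lambda> = urn_index m a \<sigma>"
    and "\<Lambda> \<le> 1 / 2"
    and "int (W0 + B0) + int m * (a (m - 1) - a m) > 0"
    and "\<Lambda> \<noteq> 0"
    and "a m \<noteq> 0" and "b 0 \<noteq> 0"
  shows "(\<Lambda> < 1 / 2 \<longrightarrow>
      weak_conv_m
        (\<lambda>n. distr M borel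
               (\<lambda>\<omega>. (real_of_int (W n \<omega>) - real_of_int (a m) / (1 - \<Lambda>) * real n) / sqrt (real n)))
        (normal_law 0
           (real_of_int (a m) * real_of_int (b 0) * \<Lambda>\<^sup>2 / (real m * (1 - \<Lambda>)\<^sup>2 * (1 - 2 * \<Lambda>)))))
    \<and> (\<Lambda> = 1 / 2 \<longrightarrow>
      weak_conv_m
        (\<lambda>n. distr M borel
               (\<lambda>\<omega>. (real_of_int (W n \<omega>) - 2 * real_of_int (a m) * real n)
                    / sqrt (real n * ln (real n))))
        (normal_law 0 (real_of_int (a m) * real_of_int (b 0) / real m)))"
proof -
  interpret nondegenerate_urn mdl m W0 B0 a b \<sigma> M K \<Lambda>
    using assms by unfold_locales auto
  have W: "W = white_balls a m W0 K" by fact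
  have G: "G = (\<lambda>n. 1 + \<Lambda> / (real n + real (W0 + B0) / of_int \<sigma>))"
    by (rule ext) (rule G_eq)
  show ?thesis
  proof (intro conjI impI)
    assume less: "\<Lambda> < 1 / 2"
    have "recursion_scale G real (1 - 2 * \<Lambda>)"
      unfolding G using less G_nonneg by (intro recursion_scale_linear) (simp_all add: G)
    moreover have "(\<lambda>n. real n / (real n)\<^sup>2) \<longlonglongrightarrow> 0" by real_asymp
    ultimately have "weak_conv_m (\<lambda>n. distr M borel
        (\<lambda>\<omega>. (real_of_int (W n \<omega>) - real_of_int (a m) / (1 - \<Lambda>) * real n) / sqrt (real n)))
        (normal_law 0 (v / (1 - 2 * \<Lambda>)))"
      unfolding W by (rule central_limit)
    thus "weak_conv_m (\<lambda>n. distr M borel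
        (\<lambda>\<omega>. (real_of_int (W n \<omega>) - real_of_int (a m) / (1 - \<Lambda>) * real n) / sqrt (real n)))
        (normal_law 0 (real_of_int (a m) * real_of_int (b 0) * \<Lambda>\<^sup>2 / (real m * (1 - \<Lambda>)\<^sup>2 * (1 - 2 * \<Lambda>))))"
      by (simp add: v_eq mult.assoc)
  next
    assume half: "\<Lambda> = 1 / 2"
    have "recursion_scale G (\<lambda>n. real n * ln (real n)) 1"
      using G_nonneg recursion_scale_log[of "real (W0 + B0) / of_int \<sigma>"] by (simp add: G half)
    moreover have "(\<lambda>n. real n * ln (real n) / (real n)\<^sup>2) \<longlonglongrightarrow> 0" by real_asymp
    ultimately have "weak_conv_m (\<lambda>n. distr M borel
        (\<lambda>\<omega>. (real_of_int (W n \<omega>) - real_of_int (a m) / (1 - \<Lambda>) * real n) / sqrt (real n * ln (real n))))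
        (normal_law 0 (v / 1))"
      unfolding W by (rule central_limit)
    \<comment> \<open>For \<open>\<Lambda> = 1/2\<close> the factor
      \<open>\<Lambda>\<^sup>2 / (1 - \<Lambda>)\<^sup>2\<close> in \<open>v_eq\<close> is 1, and
      \<open>a m / (1 - \<Lambda>)\<close> is \<open>2 * a m\<close>.\<close>
    thus "weak_conv_m (\<lambda>n. distr M borel
        (\<lambda>\<omega>. (real_of_int (W n \<omega>) - 2 * real_of_int (a m) * real n) / sqrt (real n * ln (real n))))
        (normal_law 0 (real_of_int (a m) * real_of_int (b 0) / real m))"
      unfolding v_eq by (simp add: half power2_eq_square mult.commute)
  qed
qed

end
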